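(* There exists a universal constant $C > 0$ such that the following holds. Let $\varphi$ be a satisfiable equality-free sentence of the Triguarded Fragment $\mathrm{TGF}$. Then $\varphi$ has a finite model whose domain size is at most $2^{2^{\,C \cdot |\varphi|\cdot\log|\varphi|}}$.
   Context: First-order logic with relation and constant symbols, no function symbols. The Triguarded Fragment $\mathrm{TGF}$ is the smallest set of first-order formulas such that: (i) every atomic formula is in $\mathrm{TGF}$; (ii) $\mathrm{TGF}$ is closed under Boolean connectives; (iii) if $\bar x$ is a tuple of variables, $\psi\in\mathrm{TGF}$ and $\gamma$ is an atomic formula containing all variables of $\bar x$ and all free variables of $\psi$, then $\exists\bar x(\gamma\wedge\psi)$ and $\forall\bar x(\gamma\to\psi)$ are in $\mathrm{TGF}$; (iv) if $x,y$ are variables and $\psi\in\mathrm{TGF}$ has free variables among $\{x,y\}$, then $\exists x\,\psi$ and $\forall x\,\psi$ are in $\mathrm{TGF}$. A formula is equality-free if it does not use the equality symbol. The length $|\varphi|$ is the uniform length: each occurrence of a symbol (parenthesis, connective, quantifier, variable, relation symbol, constant) contributes $1$. *)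

theory Defs
  imports Complex_Main "HOL-Library.Countable_Set"
begin

type_synonym var = nat

datatype trm = Var var | Const nat

datatype fm =
    Rel nat "trm list"
  | Eq trm trm
  | Neg fm
  | Conj fm fm
  | Disj fm fm
  | Imp fm fm
  | Iff fm fm
  | Exists var fm
  | Forall var fm

fun vars_trm :: "trm \<Rightarrow> var set" where
  "vars_trm (Var x) = {x}"
| "vars_trm (Const c) = {}"

fun fv :: "fm \<Rightarrow> var set" where
  "fv (Rel R ts) = (\<Union>t\<in>set ts. vars_trm t)"
| "fv (Eq s t) = vars_trm s \<union> vars_trm t"
| "fv (Neg \<phi>) = fv \<phi>"
| "fv (Conj \<phi> \<psi>) = fv \<phi> \<union> fv \<psi>"
| "fv (Disj \<phi> \<psi>) = fv \<phi> \<union> fv \<psi>"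
| "fv (Imp \<phi> \<psi>) = fv \<phi> \<union> fv \<psi>"
| "fv (Iff \<phi> \<psi>) = fv \<phi> \<union> fv \<psi>"
| "fv (Exists x \<phi>) = fv \<phi> - {x}"
| "fv (Forall x \<phi>) = fv \<phi> - {x}"

definition sentence :: "fm \<Rightarrow> bool" where
  "sentence \<phi> \<longleftrightarrow> fv \<phi> = {}"

fun atomic :: "fm \<Rightarrow> bool" where
  "atomic (Rel R ts) = True"
| "atomic (Eq s t) = True"
| "atomic _ = False"

fun respects_arity :: "(nat \<Rightarrow> nat) \<Rightarrow> fm \<Rightarrow> bool" where
  "respects_arity ar (Rel R ts) \<longleftrightarrow> length ts = ar R"
| "respects_arity ar (Eq s t) \<longleftrightarrow> True"
| "respects_arity ar (Neg \<phi>) \<longleftrightarrow> respects_arity ar \<phi>"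
| "respects_arity ar (Conj \<phi> \<psi>) \<longleftrightarrow> respects_arity ar \<phi> \<and> respects_arity ar \<psi>"
| "respects_arity ar (Disj \<phi> \<psi>) \<longleftrightarrow> respects_arity ar \<phi> \<and> respects_arity ar \<psi>"
| "respects_arity ar (Imp \<phi> \<psi>) \<longleftrightarrow> respects_arity ar \<phi> \<and> respects_arity ar \<psi>"
| "respects_arity ar (Iff \<phi> \<psi>) \<longleftrightarrow> respects_arity ar \<phi> \<and> respects_arity ar \<psi>"
| "respects_arity ar (Exists x \<phi>) \<longleftrightarrow> respects_arity ar \<phi>"
| "respects_arity ar (Forall x \<phi>) \<longleftrightarrow> respects_arity ar \<phi>"

fun equality_free :: "fm \<Rightarrow> bool" where
  "equality_free (Rel R ts) \<longleftrightarrow> True"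
| "equality_free (Eq s t) \<longleftrightarrow> False"
| "equality_free (Neg \<phi>) \<longleftrightarrow> equality_free \<phi>"
| "equality_free (Conj \<phi> \<psi>) \<longleftrightarrow> equality_free \<phi> \<and> equality_free \<psi>"
| "equality_free (Disj \<phi> \<psi>) \<longleftrightarrow> equality_free \<phi> \<and> equality_free \<psi>"
| "equality_free (Imp \<phi> \<psi>) \<longleftrightarrow> equality_free \<phi> \<and> equality_free \<psi>"
| "equality_free (Iff \<phi> \<psi>) \<longleftrightarrow> equality_free \<phi> \<and> equality_free \<psi>"
| "equality_free (Exists x \<phi>) \<longleftrightarrow> equality_free \<phi>"
| "equality_free (Forall x \<phi>) \<longleftrightarrow> equality_free \<phi>"

text \<open>A block of quantifiers over a tuple \<open>xs\<close> is the iterated quantifier \<open>foldr Exists xs\<close>.\<close>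

inductive_set TGF :: "fm set" where
  atom: "atomic \<phi> \<Longrightarrow> \<phi> \<in> TGF"
| neg: "\<phi> \<in> TGF \<Longrightarrow> Neg \<phi> \<in> TGF"
| conj: "\<phi> \<in> TGF \<Longrightarrow> \<psi> \<in> TGF \<Longrightarrow> Conj \<phi> \<psi> \<in> TGF"
| disj: "\<phi> \<in> TGF \<Longrightarrow> \<psi> \<in> TGF \<Longrightarrow> Disj \<phi> \<psi> \<in> TGF"
| imp: "\<phi> \<in> TGF \<Longrightarrow> \<psi> \<in> TGF \<Longrightarrow> Imp \<phi> \<psi> \<in> TGF"
| iff: "\<phi> \<in> TGF \<Longrightarrow> \<psi> \<in> TGF \<Longrightarrow> Iff \<phi> \<psi> \<in> TGF"
| guarded_ex: "\<psi> \<in> TGF \<Longrightarrow> atomic \<gamma> \<Longrightarrow> set xs \<union> fv \<psi> \<subseteq> fv \<gamma> \<Longrightarrow> foldr Exists xs (Conj \<gamma> \<psi>) \<in> TGF"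
| guarded_all: "\<psi> \<in> TGF \<Longrightarrow> atomic \<gamma> \<Longrightarrow> set xs \<union> fv \<psi> \<subseteq> fv \<gamma> \<Longrightarrow> foldr Forall xs (Imp \<gamma> \<psi>) \<in> TGF"
| two_var_ex: "\<psi> \<in> TGF \<Longrightarrow> fv \<psi> \<subseteq> {x, y} \<Longrightarrow> Exists x \<psi> \<in> TGF"
| two_var_all: "\<psi> \<in> TGF \<Longrightarrow> fv \<psi> \<subseteq> {x, y} \<Longrightarrow> Forall x \<psi> \<in> TGF"

text \<open>
  Uniform length of the fully parenthesised notation: an atom is written \<open>R(t\<^sub>1 \<dots> t\<^sub>k)\<close> or
  \<open>s = t\<close>, a binary compound \<open>(\<phi> \<circ> \<psi>)\<close>, a negation \<open>\<not>\<phi>\<close> and a quantification \<open>Qx \<phi>\<close>.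
\<close>

fun fm_length :: "fm \<Rightarrow> nat" where
  "fm_length (Rel R ts) = length ts + 3"
| "fm_length (Eq s t) = 3"
| "fm_length (Neg \<phi>) = fm_length \<phi> + 1"
| "fm_length (Conj \<phi> \<psi>) = fm_length \<phi> + fm_length \<psi> + 3"
| "fm_length (Disj \<phi> \<psi>) = fm_length \<phi> + fm_length \<psi> + 3"
| "fm_length (Imp \<phi> \<psi>) = fm_length \<phi> + fm_length \<psi> + 3"
| "fm_length (Iff \<phi> \<psi>) = fm_length \<phi> + fm_length \<psi> + 3"
| "fm_length (Exists x \<phi>) = fm_length \<phi> + 2"
| "fm_length (Forall x \<phi>) = fm_length \<phi> + 2"

record 'a struct =
  universe :: "'a set"
  rel_of :: "nat \<Rightarrow> 'a list set"
  const_of :: "nat \<Rightarrow> 'a"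

definition is_struct :: "(nat \<Rightarrow> nat) \<Rightarrow> 'a struct \<Rightarrow> bool" where
  "is_struct ar M \<longleftrightarrow>
     universe M \<noteq> {} \<and>
     (\<forall>R. rel_of M R \<subseteq> {as. length as = ar R \<and> set as \<subseteq> universe M}) \<and>
     (\<forall>c. const_of M c \<in> universe M)"

fun val :: "'a struct \<Rightarrow> (var \<Rightarrow> 'a) \<Rightarrow> trm \<Rightarrow> 'a" where
  "val M e (Var x) = e x"
| "val M e (Const c) = const_of M c"

fun sat :: "'a struct \<Rightarrow> (var \<Rightarrow> 'a) \<Rightarrow> fm \<Rightarrow> bool" where
  "sat M e (Rel R ts) \<longleftrightarrow> map (val M e) ts \<in> rel_of M R"
| "sat M e (Eq s t) \<longleftrightarrow> val M e s = val M e t"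
| "sat M e (Neg \<phi>) \<longleftrightarrow> \<not> sat M e \<phi>"
| "sat M e (Conj \<phi> \<psi>) \<longleftrightarrow> sat M e \<phi> \<and> sat M e \<psi>"
| "sat M e (Disj \<phi> \<psi>) \<longleftrightarrow> sat M e \<phi> \<or> sat M e \<psi>"
| "sat M e (Imp \<phi> \<psi>) \<longleftrightarrow> (sat M e \<phi> \<longrightarrow> sat M e \<psi>)"
| "sat M e (Iff \<phi> \<psi>) \<longleftrightarrow> (sat M e \<phi> \<longleftrightarrow> sat M e \<psi>)"
| "sat M e (Exists x \<phi>) \<longleftrightarrow> (\<exists>a\<in>universe M. sat M (e(x := a)) \<phi>)"
| "sat M e (Forall x \<phi>) \<longleftrightarrow> (\<forall>a\<in>universe M. sat M (e(x := a)) \<phi>)"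

definition is_model :: "(nat \<Rightarrow> nat) \<Rightarrow> 'a struct \<Rightarrow> fm \<Rightarrow> bool" where
  "is_model ar M \<phi> \<longleftrightarrow>
     is_struct ar M \<and> (\<forall>e. range e \<subseteq> universe M \<longrightarrow> sat M e \<phi>)"

text \<open>
  HOL cannot quantify over the type of the domain inside a formula. By the downward
  Loewenheim-Skolem theorem, proved below as
  \<open>is_model_imp_satisfiable\<close>, domains in \<open>nat\<close> lose nothing: a formula with a model over any
  type whatsoever is satisfiable in the following sense.
\<close>

definition satisfiable :: "(nat \<Rightarrow> nat) \<Rightarrow> fm \<Rightarrow> bool" where
  "satisfiable ar \<phi> \<longleftrightarrow> (\<exists>M :: nat struct. is_model ar M \<phi>)"

instance trm :: countable by countable_datatype
instance fm :: countable by countable_datatype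

lemma sat_cong:
  assumes "\<forall>x\<in>fv \<phi>. e x = e' x"
  shows "sat M e \<phi> \<longleftrightarrow> sat M e' \<phi>"
  using assms
proof (induction \<phi> arbitrary: e e')
  case (Rel R ts)
  have "val M e t = val M e' t" if "t \<in> set ts" for t
    using Rel that by (cases t) force+
  then have "map (val M e) ts = map (val M e') ts" by simp
  then show ?case by (simp only: sat.simps)
next
  case (Eq s t)
  then show ?case by (cases s; cases t) auto
next
  case (Neg \<phi>)
  then show ?case by (metis sat.simps(3) fv.simps(3))
next
  case (Conj \<phi> \<psi>)
  then show ?case by (metis sat.simps(4) fv.simps(4) UnCI)
next
  case (Disj \<phi> \<psi>)
  then show ?case by (metis sat.simps(5) fv.simps(5) UnCI)
next
  case (Imp \<phi> \<psi>)
  then show ?case by (metis sat.simps(6) fv.simps(6) UnCI)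
next
  case (Iff \<phi> \<psi>)
  then show ?case by (metis sat.simps(7) fv.simps(7) UnCI)
next
  case (Exists x \<phi>)
  have "sat M (e(x := a)) \<phi> \<longleftrightarrow> sat M (e'(x := a)) \<phi>" for a
    using Exists.prems by (intro Exists.IH) auto
  then show ?case by simp
next
  case (Forall x \<phi>)
  have "sat M (e(x := a)) \<phi> \<longleftrightarrow> sat M (e'(x := a)) \<phi>" for a
    using Forall.prems by (intro Forall.IH) auto
  then show ?case by simp
qed

lemma finite_fv: "finite (fv \<phi>)"
proof -
  have "finite (vars_trm t)" for t by (cases t) auto
  then show ?thesis by (induction \<phi>) auto
qed

text \<open>Terms naming the elements of the Skolem hull of the constants and a base point.\<close>

datatype hull_term = Base | HConst nat | Wit fm var "hull_term list"

instance hull_term :: countable by countable_datatype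

definition list_env :: "'a \<Rightarrow> 'a list \<Rightarrow> var \<Rightarrow> 'a" where
  "list_env d as x = (if x < length as then as ! x else d)"

definition witness :: "'a struct \<Rightarrow> 'a \<Rightarrow> fm \<Rightarrow> var \<Rightarrow> (var \<Rightarrow> 'a) \<Rightarrow> 'a" where
  "witness M d \<phi> x e =
     (if \<exists>a\<in>universe M. sat M (e(x := a)) \<phi>
      then SOME a. a \<in> universe M \<and> sat M (e(x := a)) \<phi> else d)"

primrec hull_val :: "'a struct \<Rightarrow> 'a \<Rightarrow> hull_term \<Rightarrow> 'a" where
  "hull_val M d Base = d"
| "hull_val M d (HConst c) = const_of M c"
| "hull_val M d (Wit \<phi> x hs) = witness M d \<phi> x (list_env d (map (hull_val M d) hs))"

lemma witness:
  assumes "d \<in> universe M"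
  shows "witness M d \<phi> x e \<in> universe M"
    and "\<exists>a\<in>universe M. sat M (e(x := a)) \<phi> \<Longrightarrow> sat M (e(x := witness M d \<phi> x e)) \<phi>"
proof -
  have *: "witness M d \<phi> x e \<in> universe M \<and> sat M (e(x := witness M d \<phi> x e)) \<phi>"
    if "\<exists>a\<in>universe M. sat M (e(x := a)) \<phi>"
    using that someI_ex[of "\<lambda>a. a \<in> universe M \<and> sat M (e(x := a)) \<phi>"]
    by (auto simp: witness_def)
  then show "\<exists>a\<in>universe M. sat M (e(x := a)) \<phi> \<Longrightarrow> sat M (e(x := witness M d \<phi> x e)) \<phi>"
    by blast
  show "witness M d \<phi> x e \<in> universe M"
    using * assms by (cases "\<exists>a\<in>universe M. sat M (e(x := a)) \<phi>") (auto simp: witness_def)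
qed

lemma hull_closed:
  assumes d: "d \<in> universe M" and e: "range e \<subseteq> range (hull_val M d)"
    and ex: "\<exists>a\<in>universe M. sat M (e(x := a)) \<phi>"
  shows "\<exists>a\<in>range (hull_val M d). sat M (e(x := a)) \<phi>"
proof -
  obtain n where n: "\<forall>y\<in>fv \<phi>. y < n"
    using finite_fv[of \<phi>] finite_nat_set_iff_bounded by auto
  have "\<forall>y. \<exists>h. e y = hull_val M d h" using e by blast
  then obtain h where h: "\<And>y. e y = hull_val M d (h y)" by metis
  define e' where "e' = list_env d (map (hull_val M d) (map h [0..<n]))"
  have agree: "e' y = e y" if "y \<in> fv \<phi>" for y
    using n that by (simp add: e'_def list_env_def h)
  have cong: "sat M (e(x := a)) \<phi> \<longleftrightarrow> sat M (e'(x := a)) \<phi>" for a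
    by (rule sat_cong) (simp add: agree)
  have "sat M (e'(x := hull_val M d (Wit \<phi> x (map h [0..<n])))) \<phi>"
    using witness(2)[OF d, of e' x \<phi>] ex cong by (simp add: e'_def)
  then show ?thesis using cong by blast
qed

lemma is_model_imp_satisfiable:
  fixes M :: "'a struct"
  assumes "is_model ar M \<phi>"
  shows "satisfiable ar \<phi>"
proof -
  have M: "is_struct ar M" and holds: "\<And>e. range e \<subseteq> universe M \<Longrightarrow> sat M e \<phi>"
    using assms by (auto simp: is_model_def)
  obtain d where d: "d \<in> universe M" using M by (auto simp: is_struct_def)
  define S where "S = range (hull_val M d)"
  have sub: "S \<subseteq> universe M"
  proof -
    have "hull_val M d h \<in> universe M" for h
      by (cases h) (use d M in \<open>auto simp: is_struct_def intro: witness\<close>)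
    then show ?thesis by (auto simp: S_def)
  qed
  have const_in: "const_of M c \<in> S" for c
    using rangeI[of "hull_val M d" "HConst c"] by (simp add: S_def)
  have "d \<in> S" using rangeI[of "hull_val M d" Base] by (simp add: S_def)
  have "countable S" by (simp add: S_def)
  define f where "f = to_nat_on S"
  have inj: "inj_on f S" unfolding f_def using \<open>countable S\<close> by (rule inj_on_to_nat_on)
  define N where "N = \<lparr>universe = f ` S,
     rel_of = (\<lambda>R. map f ` {as \<in> rel_of M R. set as \<subseteq> S}), const_of = f \<circ> const_of M\<rparr>"
  have "length as = ar R" if "as \<in> rel_of M R" for as R
    using M that by (auto simp: is_struct_def)
  then have N: "is_struct ar N"
    using const_in \<open>d \<in> S\<close> by (auto simp: is_struct_def N_def subset_iff)
  have val: "val N (f \<circ> e) t = f (val M e t) \<and> val M e t \<in> S" if "range e \<subseteq> S" for e t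
    using that const_in by (cases t) (auto simp: N_def)
  have upd: "(f \<circ> e)(x := f a) = f \<circ> e(x := a)" for e x a by auto
  have transfer: "sat N (f \<circ> e) \<psi> \<longleftrightarrow> sat M e \<psi>" if "range e \<subseteq> S" for e \<psi>
    using that
  proof (induction \<psi> arbitrary: e)
    case (Rel R ts)
    have eq: "map (val N (f \<circ> e)) ts = map f (map (val M e) ts)"
      using val[OF Rel] by simp
    have in_S: "set (map (val M e) ts) \<subseteq> S" using val[OF Rel] by auto
    have map_inj: "map f as = map f bs \<Longrightarrow> set as \<subseteq> S \<Longrightarrow> set bs \<subseteq> S \<Longrightarrow> as = bs" for as bs
      using inj by (metis inj_on_subset map_inj_on Un_least)
    have "map f as \<in> rel_of N R \<longleftrightarrow> as \<in> rel_of M R" if "set as \<subseteq> S" for as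
      using that by (auto simp: N_def dest: map_inj)
    from this[OF in_S] show ?case unfolding sat.simps eq .
  next
    case (Eq s t)
    then show ?case unfolding sat.simps using val[OF Eq] inj by (metis inj_onD)
  next
    case (Exists x \<psi>)
    have env: "range (e(x := a)) \<subseteq> S" if "a \<in> S" for a using that Exists.prems by auto
    have "sat N (f \<circ> e) (Exists x \<psi>) \<longleftrightarrow> (\<exists>a\<in>S. sat N (f \<circ> e(x := a)) \<psi>)"
      by (simp add: N_def flip: upd)
    also have "\<dots> \<longleftrightarrow> (\<exists>a\<in>S. sat M (e(x := a)) \<psi>)" using Exists.IH env by blast
    also have "\<dots> \<longleftrightarrow> sat M e (Exists x \<psi>)"
      using hull_closed[OF d, of e x \<psi>, folded S_def] Exists.prems sub unfolding sat.simps by blast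
    finally show ?case .
  next
    case (Forall x \<psi>)
    have env: "range (e(x := a)) \<subseteq> S" if "a \<in> S" for a using that Forall.prems by auto
    have "sat N (f \<circ> e) (Forall x \<psi>) \<longleftrightarrow> (\<forall>a\<in>S. sat N (f \<circ> e(x := a)) \<psi>)"
      by (simp add: N_def flip: upd)
    also have "\<dots> \<longleftrightarrow> (\<forall>a\<in>S. sat M (e(x := a)) \<psi>)" using Forall.IH env by blast
    also have "\<dots> \<longleftrightarrow> sat M e (Forall x \<psi>)"
      using hull_closed[OF d, of e x "Neg \<psi>", folded S_def] Forall.prems sub unfolding sat.simps by blast
    finally show ?case .
  qed simp_all
  have "sat N e \<phi>" if "range e \<subseteq> universe N" for e
  proof -
    have "\<forall>x. \<exists>a\<in>S. e x = f a" using that by (auto simp: N_def)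
    then obtain e' where e': "\<And>x. e' x \<in> S" "\<And>x. e x = f (e' x)" by metis
    have "e = f \<circ> e'" using e' by auto
    moreover have "sat M e' \<phi>" using holds e'(1) sub by blast
    ultimately show ?thesis using transfer[of e' \<phi>] e'(1) by auto
  qed
  then show ?thesis using N by (auto simp: satisfiable_def is_model_def)
qed

end

theory Submission
  imports Defs "HOL-Library.FuncSet" "HOL-Library.Disjoint_Sets"
begin

text \<open>
  Following Gurevich and Shelah, a finite model is built at random from an arbitrary model \<open>A\<close>.
  Every small set \<open>S\<close> of new elements tries, in order of increasing size, to get a map
  \<open>S \<rightarrow> A\<close> whose type (the truth values of all subformulas) is compatible with the types chosen
  for its proper subsets; if there is none, \<open>S\<close> and all its supersets are dead and carry no atom.
  A random proposal is used whenever it is compatible. As equality is absent, maps need not be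
  injective and all pairs are live; guarded tuples are live because an atom holds on them, so no
  quantifier of a triguarded formula ever looks at a dead set. A witness in \<open>A\<close> for a live set
  \<open>S\<close> is copied to a new element \<open>b\<close> as soon as the proposals for the sets \<open>T \<union> {b}\<close> with
  \<open>T \<subseteq> S\<close> are the right ones. These events are independent for different \<open>b\<close> and their
  probability is bounded below in terms of the number of types, so by a union bound doubly
  exponentially many elements suffice.
\<close>

section \<open>Random extension property\<close>

text \<open>Independence in counting form: for a uniform \<open>f\<close>, the events that
  \<open>f\<close> copies \<open>g b\<close> on \<open>D b\<close> concern disjoint blocks of at
  most \<open>c\<close> arguments, so each has probability at least \<open>1 / M ^ c\<close> and the
  probabilities of failure multiply. The induction splits off one block.\<close>

lemma card_avoiding_le:
  fixes M c :: nat and D :: "'b \<Rightarrow> 'a set"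
  assumes "finite B" "finite X" "M > 0"
    and "\<And>b. b \<in> B \<Longrightarrow> D b \<subseteq> X \<and> card (D b) \<le> c"
    and "disjoint_family_on D B"
    and "\<And>b x. b \<in> B \<Longrightarrow> x \<in> D b \<Longrightarrow> g b x < M"
  shows "real (card {f \<in> PiE X (\<lambda>_. {..<M}). \<forall>b\<in>B. \<exists>x\<in>D b. f x \<noteq> g b x})
    \<le> (1 - 1 / real M ^ c) ^ card B * real M ^ card X"
  using assms
proof (induction B arbitrary: X rule: finite_induct)
  case empty
  then show ?case by (simp add: card_PiE)
next
  case (insert b B)
  define Y where "Y = X - D b"
  have D: "D b \<subseteq> X" "card (D b) \<le> c" using insert.prems(3) by auto
  then have finD: "finite (D b)" using insert.prems(1) finite_subset by blast
  have X: "X = D b \<union> Y" "D b \<inter> Y = {}" "finite Y" using D insert.prems(1) by (auto simp: Y_def)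
  define bad where "bad = (\<lambda>X B. {f \<in> PiE X (\<lambda>_. {..<M}). \<forall>b\<in>B. \<exists>x\<in>D b. f x \<noteq> g b x})"
  \<comment> \<open>The failing restrictions to the block \<open>D b\<close> are all but one. A bad
    \<open>f\<close> is determined by its restriction in \<open>U\<close> together with a bad
    function on \<open>Y\<close>.\<close>
  define U where "U = PiE (D b) (\<lambda>_. {..<M}) - {restrict (g b) (D b)}"
  have sub: "D b' \<subseteq> Y" if "b' \<in> B" for b'
  proof -
    have "D b' \<inter> D b = {}"
      using that insert.hyps(2) insert.prems(4) by (metis disjoint_family_onD insertCI)
    then show ?thesis using insert.prems(3)[of b'] that by (auto simp: Y_def)
  qed
  have IH: "real (card (bad Y B)) \<le> (1 - 1 / real M ^ c) ^ card B * real M ^ card Y"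
    unfolding bad_def
  proof (rule insert.IH)
    show "disjoint_family_on D B"
      using insert.prems(4) by (auto simp: disjoint_family_on_def)
    show "D b' \<subseteq> Y \<and> card (D b') \<le> c" if "b' \<in> B" for b'
      using insert.prems(3)[of b'] sub that by simp
  qed (use insert.prems(2,5) X(3) in auto)
  have fin: "finite (PiE Z (\<lambda>_. {..<M}))" if "finite Z" for Z :: "'a set"
    using that by (intro finite_PiE) auto
  have "restrict (g b) (D b) \<in> PiE (D b) (\<lambda>_. {..<M})" using insert.prems(5) by auto
  then have cU: "card U = M ^ card (D b) - 1"
    unfolding U_def using finD by (simp add: card_PiE)
  have "card (bad X (insert b B)) \<le> card (U \<times> bad Y B)"
  proof (rule card_inj_on_le[where f = "\<lambda>f. (restrict f (D b), restrict f Y)"])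
    show "inj_on (\<lambda>f. (restrict f (D b), restrict f Y)) (bad X (insert b B))"
    proof (rule inj_onI, rule ext)
      fix f f' x
      assume f: "f \<in> bad X (insert b B)" "f' \<in> bad X (insert b B)"
        and eq: "(restrict f (D b), restrict f Y) = (restrict f' (D b), restrict f' Y)"
      show "f x = f' x"
      proof (cases "x \<in> X")
        case True
        then consider "x \<in> D b" | "x \<in> Y" using X(1) by blast
        then show ?thesis using eq by cases (metis prod.inject restrict_apply')+
      next
        case False
        then show ?thesis using f by (auto simp: bad_def PiE_def extensional_def)
      qed
    qed
    show "(\<lambda>f. (restrict f (D b), restrict f Y)) ` bad X (insert b B) \<subseteq> U \<times> bad Y B"
    proof (rule image_subsetI, rule SigmaI)
      fix f assume f: "f \<in> bad X (insert b B)"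
      then have "\<exists>x\<in>D b. f x \<noteq> g b x" by (auto simp: bad_def)
      then have "restrict f (D b) \<noteq> restrict (g b) (D b)" by (metis restrict_apply')
      then show "restrict f (D b) \<in> U" using f X(1) by (auto simp: U_def bad_def)
      have "\<exists>x\<in>D b'. restrict f Y x \<noteq> g b' x" if "b' \<in> B" for b'
      proof -
        obtain x where "x \<in> D b'" "f x \<noteq> g b' x" using f \<open>b' \<in> B\<close> unfolding bad_def by blast
        then show ?thesis using sub[OF \<open>b' \<in> B\<close>] by (metis restrict_apply' subsetD)
      qed
      then show "restrict f Y \<in> bad Y B" using f X(1) by (auto simp: bad_def)
    qed
    show "finite (U \<times> bad Y B)" using fin[OF finD] fin[OF X(3)] by (simp add: U_def bad_def)
  qed
  then have "real (card (bad X (insert b B))) \<le> real (card U) * real (card (bad Y B))"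
    by (metis card_cartesian_product of_nat_le_iff of_nat_mult)
  also have "real (card U) \<le> real M ^ card (D b) * (1 - 1 / real M ^ c)"
  proof -
    have "real (card U) = real M ^ card (D b) * (1 - 1 / real M ^ card (D b))"
      using insert.prems(2) by (simp add: cU of_nat_diff algebra_simps)
    also have "\<dots> \<le> real M ^ card (D b) * (1 - 1 / real M ^ c)"
      using insert.prems(2) D(2)
      by (intro mult_left_mono diff_left_mono divide_left_mono power_increasing) auto
    finally show ?thesis .
  qed
  also have "real M ^ card (D b) * (1 - 1 / real M ^ c) * real (card (bad Y B)) \<le>
      real M ^ card (D b) * (1 - 1 / real M ^ c) * ((1 - 1 / real M ^ c) ^ card B * real M ^ card Y)"
    using insert.prems(2) by (intro mult_left_mono[OF IH] mult_nonneg_nonneg) auto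
  also have "\<dots> = (1 - 1 / real M ^ c) ^ card (insert b B) * real M ^ card X"
    using insert.hyps X finD by (simp add: card_Un_disjoint power_add)
  finally show ?case by (simp add: bad_def mult_right_mono)
qed

lemma card_small_subsets_le: "card {S. S \<subseteq> {..<N::nat} \<and> card S \<le> k} \<le> (N + 1) ^ k"
proof -
  define L where "L = {xs. set xs \<subseteq> {..N} \<and> length xs = k}"
  have "{S. S \<subseteq> {..<N} \<and> card S \<le> k} \<subseteq> (\<lambda>xs. set xs - {N}) ` L"
  proof clarify
    fix S assume S: "S \<subseteq> {..<N}" "card S \<le> k"
    \<comment> \<open>Padding with \<open>N\<close>, which lies outside \<open>{..<N}\<close>,
      brings every list to length exactly \<open>k\<close> and is removed again by
      \<open>set xs - {N}\<close>.\<close>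
    define xs where "xs = sorted_list_of_set S @ replicate (k - card S) N"
    have "finite S" using S finite_subset by blast
    then have "xs \<in> L" "S = set xs - {N}" using S by (auto simp: xs_def L_def)
    then show "S \<in> (\<lambda>xs. set xs - {N}) ` L" by blast
  qed
  moreover have "finite L" unfolding L_def by (intro finite_lists_length_eq) auto
  ultimately have "card {S. S \<subseteq> {..<N} \<and> card S \<le> k} \<le> card L" by (rule surj_card_le[rotated])
  then show ?thesis by (simp add: L_def card_lists_length_eq)
qed

text \<open>Sets receive random colours below \<open>M\<close>. A request is a small base
  \<open>S\<close> with an index \<open>p < P\<close>; an element \<open>b\<close> fulfils it if all
  sets \<open>insert b T\<close> with \<open>T \<subseteq> S\<close> have the colours prescribed by
  \<open>g\<close>. For distinct \<open>b\<close> outside \<open>S\<close> these families of at most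
  \<open>2 ^ k\<close> sets are disjoint, so \<open>card_avoiding_le\<close> bounds the failure of
  one request, and \<open>small\<close> is the union bound over all requests.\<close>

lemma ex_extension_coloring:
  fixes M k N P :: nat and g :: "nat set \<Rightarrow> nat \<Rightarrow> nat \<Rightarrow> nat set \<Rightarrow> nat"
  assumes g: "\<And>S p b T. g S p b T < M"
    and small: "real P * real (N + 1) ^ k * (1 - 1 / real M ^ 2 ^ k) ^ (N - k) < 1"
  shows "\<exists>f. (\<forall>T. f T < M) \<and>
    (\<forall>S p. S \<subseteq> {..<N} \<longrightarrow> card S \<le> k \<longrightarrow> p < P \<longrightarrow>
      (\<exists>b<N. b \<notin> S \<and> (\<forall>T\<subseteq>S. f (insert b T) = g S p b (insert b T))))"
proof -
  have M: "M > 0" using g by (metis gr_zeroI not_less0)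
  define X where "X = Pow {..<N}"
  define \<Omega> where "\<Omega> = PiE X (\<lambda>_. {..<M})"
  define I where "I = {S. S \<subseteq> {..<N} \<and> card S \<le> k} \<times> {..<P}"
  define bad where "bad = (\<lambda>(S, p). {f \<in> \<Omega>. \<forall>b\<in>{..<N} - S. \<exists>x\<in>insert b ` Pow S. f x \<noteq> g S p b x})"
  define r where "r = 1 - 1 / real M ^ 2 ^ k"
  have r: "0 \<le> r" "r \<le> 1" using M by (auto simp: r_def)
  have finX: "finite X" by (simp add: X_def)
  have "finite {S. S \<subseteq> {..<N} \<and> card S \<le> k}" by (rule finite_subset[of _ X]) (auto simp: X_def)
  then have finI: "finite I" by (simp add: I_def)
  have cI: "real (card I) \<le> real P * real (N + 1) ^ k"
  proof -
    have "card I \<le> (N + 1) ^ k * P"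
      unfolding I_def card_cartesian_product using card_small_subsets_le by simp
    then show ?thesis by (metis mult.commute of_nat_le_iff of_nat_mult of_nat_power)
  qed
  have fin\<Omega>: "finite \<Omega>" and c\<Omega>: "card \<Omega> = M ^ card X"
    using finX by (auto simp: \<Omega>_def card_PiE intro: finite_PiE)
  have bad_sub: "bad i \<subseteq> \<Omega>" for i by (auto simp: bad_def split: prod.splits)
  have bad: "real (card (bad i)) \<le> r ^ (N - k) * real M ^ card X" if iI: "i \<in> I" for i
  proof -
    obtain S p where i: "i = (S, p)" and S: "S \<subseteq> {..<N}" "card S \<le> k"
      using iI unfolding I_def by blast
    have finS: "finite S" using S finite_subset by blast
    have "real (card (bad i)) \<le> r ^ card ({..<N} - S) * real M ^ card X"
      unfolding i bad_def \<Omega>_def r_def prod.case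
    proof (rule card_avoiding_le)
      fix b assume b: "b \<in> {..<N} - S"
      have "card (insert b ` Pow S) \<le> 2 ^ card S"
        using card_image_le[of "Pow S" "insert b"] finS by (simp add: card_Pow)
      also have "\<dots> \<le> 2 ^ k" using S by (intro power_increasing) auto
      finally show "insert b ` Pow S \<subseteq> X \<and> card (insert b ` Pow S) \<le> 2 ^ k"
        using b S by (auto simp: X_def)
    next
      show "disjoint_family_on (\<lambda>b. insert b ` Pow S) ({..<N} - S)"
        unfolding disjoint_family_on_def by auto
    qed (use finX M g in auto)
    also have "card ({..<N} - S) = N - card S" using S finS by (simp add: card_Diff_subset)
    also have "r ^ (N - card S) * real M ^ card X \<le> r ^ (N - k) * real M ^ card X"
      using r S by (intro mult_right_mono power_decreasing) auto
    finally show ?thesis .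
  qed
  have "real (card (\<Union>i\<in>I. bad i)) \<le> (\<Sum>i\<in>I. real (card (bad i)))"
    using card_UN_le[OF finI, of bad] by (metis of_nat_le_iff of_nat_sum)
  also have "\<dots> \<le> real (card I) * (r ^ (N - k) * real M ^ card X)"
    using sum_bounded_above[of I, OF bad] by simp
  also have "\<dots> \<le> real P * real (N + 1) ^ k * (r ^ (N - k) * real M ^ card X)"
    using r by (intro mult_right_mono[OF cI]) auto
  also have "\<dots> < 1 * real M ^ card X"
    unfolding mult.assoc[symmetric] using small M by (intro mult_strict_right_mono) (auto simp: r_def)
  finally have "card (\<Union>i\<in>I. bad i) < card \<Omega>"
    unfolding c\<Omega> by (metis mult_1 of_nat_less_iff of_nat_power)
  then obtain f where f: "f \<in> \<Omega>" "f \<notin> (\<Union>i\<in>I. bad i)"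
    using card_mono[of "\<Union>i\<in>I. bad i" \<Omega>] finite_subset[OF UN_least fin\<Omega>, of I bad] bad_sub
    by (meson leD subsetI)
  \<comment> \<open>Outside \<open>Pow {..<N}\<close> the function \<open>f\<close> is
    \<open>undefined\<close>; the value 0 there makes the bound \<open>M\<close> hold
    everywhere.\<close>
  define f' where "f' T = (if T \<in> X then f T else 0)" for T
  have "f' T < M" for T using f(1) M by (auto simp: f'_def \<Omega>_def PiE_def Pi_def)
  moreover have "\<exists>b<N. b \<notin> S \<and> (\<forall>T\<subseteq>S. f' (insert b T) = g S p b (insert b T))"
    if "S \<subseteq> {..<N}" "card S \<le> k" "p < P" for S p
  proof -
    have "f \<notin> bad (S, p)" using f(2) that by (auto simp: I_def)
    then obtain b where b: "b < N" "b \<notin> S" "\<And>x. x \<in> insert b ` Pow S \<Longrightarrow> f x = g S p b x"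
      using f(1) by (auto simp: bad_def)
    have "f' (insert b T) = g S p b (insert b T)" if "T \<subseteq> S" for T
      using that b \<open>S \<subseteq> {..<N}\<close> by (auto simp: f'_def X_def)
    then show ?thesis using b by blast
  qed
  ultimately show ?thesis by blast
qed


section \<open>Shape of triguarded formulas\<close>

text \<open>This is what remains of a guarded block after some of its quantifiers are stripped;
  \<open>xs\<close> may be empty, which covers the body of the innermost one.\<close>

definition ex_guarded :: "fm \<Rightarrow> bool" where
  "ex_guarded \<chi> \<longleftrightarrow>
     (\<exists>xs R ts \<psi>. \<chi> = foldr Exists xs (Conj (Rel R ts) \<psi>) \<and> fv \<psi> \<subseteq> fv (Rel R ts))"

definition all_guarded :: "fm \<Rightarrow> bool" where
  "all_guarded \<chi> \<longleftrightarrow>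
     (\<exists>xs R ts \<psi>. \<chi> = foldr Forall xs (Imp (Rel R ts) \<psi>) \<and> fv \<psi> \<subseteq> fv (Rel R ts))"

text \<open>
  A quantifier inside a guarded block is again guarded, so triguardedness can be checked one
  quantifier at a time.
\<close>

fun triguarded :: "fm \<Rightarrow> bool" where
  "triguarded (Rel R ts) \<longleftrightarrow> True"
| "triguarded (Eq s t) \<longleftrightarrow> False"
| "triguarded (Neg \<phi>) \<longleftrightarrow> triguarded \<phi>"
| "triguarded (Conj \<phi> \<psi>) \<longleftrightarrow> triguarded \<phi> \<and> triguarded \<psi>"
| "triguarded (Disj \<phi> \<psi>) \<longleftrightarrow> triguarded \<phi> \<and> triguarded \<psi>"
| "triguarded (Imp \<phi> \<psi>) \<longleftrightarrow> triguarded \<phi> \<and> triguarded \<psi>"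
| "triguarded (Iff \<phi> \<psi>) \<longleftrightarrow> triguarded \<phi> \<and> triguarded \<psi>"
| "triguarded (Exists x \<phi>) \<longleftrightarrow> triguarded \<phi> \<and> (ex_guarded \<phi> \<or> card (fv \<phi>) \<le> 2)"
| "triguarded (Forall x \<phi>) \<longleftrightarrow> triguarded \<phi> \<and> (all_guarded \<phi> \<or> card (fv \<phi>) \<le> 2)"

lemma card_fv_le_2: "fv \<psi> \<subseteq> {x, y} \<Longrightarrow> card (fv \<psi>) \<le> 2"
  by (rule order_trans[OF card_mono[of "{x, y}"]]) (auto simp: card_insert_if)

lemma TGF_triguarded: "\<phi> \<in> TGF \<Longrightarrow> equality_free \<phi> \<Longrightarrow> triguarded \<phi>"
proof (induction rule: TGF.induct)
  case (atom \<phi>)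
  then show ?case by (cases \<phi>) auto
next
  case (guarded_ex \<psi> \<gamma> xs)
  have ef: "equality_free (foldr Exists xs (Conj \<gamma> \<psi>)) = equality_free (Conj \<gamma> \<psi>)"
    by (induction xs) auto
  with guarded_ex obtain R ts where \<gamma>: "\<gamma> = Rel R ts" by (cases \<gamma>) auto
  have "ex_guarded (foldr Exists ys (Conj \<gamma> \<psi>))" for ys
    using guarded_ex(3) unfolding ex_guarded_def \<gamma> by blast
  then show ?case using guarded_ex ef \<gamma> by (induction xs) auto
next
  case (guarded_all \<psi> \<gamma> xs)
  have ef: "equality_free (foldr Forall xs (Imp \<gamma> \<psi>)) = equality_free (Imp \<gamma> \<psi>)"
    by (induction xs) auto
  with guarded_all obtain R ts where \<gamma>: "\<gamma> = Rel R ts" by (cases \<gamma>) auto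
  have "all_guarded (foldr Forall ys (Imp \<gamma> \<psi>))" for ys
    using guarded_all(3) unfolding all_guarded_def \<gamma> by blast
  then show ?case using guarded_all ef \<gamma> by (induction xs) auto
qed (auto simp: card_fv_le_2)

text \<open>The witnesses of the remaining block turn \<open>e\<close> into an \<open>e'\<close>
  that makes the guard true. Later this puts the values of \<open>e\<close> on
  \<open>fv \<chi>\<close> inside a tuple on which an atom holds, hence inside a live set.\<close>

lemma sat_ex_guarded:
  assumes "ex_guarded \<chi>" "sat M e \<chi>"
  obtains R ts e' where "sat M e' (Rel R ts)" "fv \<chi> \<subseteq> fv (Rel R ts)" "\<forall>y\<in>fv \<chi>. e' y = e y"
proof -
  obtain xs R ts \<psi> where \<chi>: "\<chi> = foldr Exists xs (Conj (Rel R ts) \<psi>)" "fv \<psi> \<subseteq> fv (Rel R ts)"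
    using assms by (auto simp: ex_guarded_def)
  have "sat M e (foldr Exists xs \<theta>) \<Longrightarrow> \<exists>e'. sat M e' \<theta> \<and> (\<forall>y. y \<notin> set xs \<longrightarrow> e' y = e y)"
    for \<theta> e by (induction xs arbitrary: e) fastforce+
  then obtain e' where e': "sat M e' (Conj (Rel R ts) \<psi>)" "\<forall>y. y \<notin> set xs \<longrightarrow> e' y = e y"
    using assms(2) \<chi>(1) by blast
  have "fv (foldr Exists xs \<theta>) = fv \<theta> - set xs" for \<theta> by (induction xs) auto
  then have "fv \<chi> = fv (Rel R ts) - set xs" using \<chi> by auto
  then show thesis using that[of e' R ts] e' by auto
qed

text \<open>A counterexample to an implication makes its premise true, so the failure of a universal
  block provides a true guard as well.\<close>

lemma not_sat_all_guarded:
  assumes "all_guarded \<chi>" "\<not> sat M e \<chi>"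
  obtains R ts e' where "sat M e' (Rel R ts)" "fv \<chi> \<subseteq> fv (Rel R ts)" "\<forall>y\<in>fv \<chi>. e' y = e y"
proof -
  obtain xs R ts \<psi> where \<chi>: "\<chi> = foldr Forall xs (Imp (Rel R ts) \<psi>)" "fv \<psi> \<subseteq> fv (Rel R ts)"
    using assms by (auto simp: all_guarded_def)
  have "\<not> sat M e (foldr Forall xs \<theta>) \<Longrightarrow> \<exists>e'. \<not> sat M e' \<theta> \<and> (\<forall>y. y \<notin> set xs \<longrightarrow> e' y = e y)"
    for \<theta> e by (induction xs arbitrary: e) fastforce+
  then obtain e' where e': "\<not> sat M e' (Imp (Rel R ts) \<psi>)" "\<forall>y. y \<notin> set xs \<longrightarrow> e' y = e y"
    using assms(2) \<chi>(1) by blast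
  have "fv (foldr Forall xs \<theta>) = fv \<theta> - set xs" for \<theta> by (induction xs) auto
  then have "fv \<chi> = fv (Rel R ts) - set xs" using \<chi> by auto
  then show thesis using that[of e' R ts] e' by auto
qed

section \<open>Subformulas, variables and constants, counted against the length\<close>

fun subfms :: "fm \<Rightarrow> fm set" where
  "subfms (Rel R ts) = {Rel R ts}"
| "subfms (Eq s t) = {Eq s t}"
| "subfms (Neg \<phi>) = insert (Neg \<phi>) (subfms \<phi>)"
| "subfms (Conj \<phi> \<psi>) = insert (Conj \<phi> \<psi>) (subfms \<phi> \<union> subfms \<psi>)"
| "subfms (Disj \<phi> \<psi>) = insert (Disj \<phi> \<psi>) (subfms \<phi> \<union> subfms \<psi>)"
| "subfms (Imp \<phi> \<psi>) = insert (Imp \<phi> \<psi>) (subfms \<phi> \<union> subfms \<psi>)"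
| "subfms (Iff \<phi> \<psi>) = insert (Iff \<phi> \<psi>) (subfms \<phi> \<union> subfms \<psi>)"
| "subfms (Exists x \<phi>) = insert (Exists x \<phi>) (subfms \<phi>)"
| "subfms (Forall x \<phi>) = insert (Forall x \<phi>) (subfms \<phi>)"

text \<open>Bound variables are included, so that this one set contains the free variables of every
  subformula and can serve as common domain of the assignments in a type.\<close>

fun all_vars :: "fm \<Rightarrow> var set" where
  "all_vars (Rel R ts) = fv (Rel R ts)"
| "all_vars (Eq s t) = fv (Eq s t)"
| "all_vars (Neg \<phi>) = all_vars \<phi>"
| "all_vars (Conj \<phi> \<psi>) = all_vars \<phi> \<union> all_vars \<psi>"
| "all_vars (Disj \<phi> \<psi>) = all_vars \<phi> \<union> all_vars \<psi>"
| "all_vars (Imp \<phi> \<psi>) = all_vars \<phi> \<union> all_vars \<psi>"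
| "all_vars (Iff \<phi> \<psi>) = all_vars \<phi> \<union> all_vars \<psi>"
| "all_vars (Exists x \<phi>) = insert x (all_vars \<phi>)"
| "all_vars (Forall x \<phi>) = insert x (all_vars \<phi>)"

fun consts_trm :: "trm \<Rightarrow> nat set" where
  "consts_trm (Var x) = {}"
| "consts_trm (Const c) = {c}"

fun consts_fm :: "fm \<Rightarrow> nat set" where
  "consts_fm (Rel R ts) = (\<Union>t\<in>set ts. consts_trm t)"
| "consts_fm (Eq s t) = consts_trm s \<union> consts_trm t"
| "consts_fm (Neg \<phi>) = consts_fm \<phi>"
| "consts_fm (Conj \<phi> \<psi>) = consts_fm \<phi> \<union> consts_fm \<psi>"
| "consts_fm (Disj \<phi> \<psi>) = consts_fm \<phi> \<union> consts_fm \<psi>"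
| "consts_fm (Imp \<phi> \<psi>) = consts_fm \<phi> \<union> consts_fm \<psi>"
| "consts_fm (Iff \<phi> \<psi>) = consts_fm \<phi> \<union> consts_fm \<psi>"
| "consts_fm (Exists x \<phi>) = consts_fm \<phi>"
| "consts_fm (Forall x \<phi>) = consts_fm \<phi>"

lemma Var_in_if_fv_Rel:
  assumes "x \<in> fv (Rel R ts)"
  shows "Var x \<in> set ts"
proof -
  obtain t where t: "t \<in> set ts" "x \<in> vars_trm t" using assms by auto
  then have "t = Var x" by (cases t rule: trm.exhaust) auto
  then show ?thesis using t by simp
qed

lemma subfms_refl: "\<phi> \<in> subfms \<phi>"
  by (cases \<phi>) auto

lemma fv_subset_all_vars: "fv \<phi> \<subseteq> all_vars \<phi>"
  by (induction \<phi>) auto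

lemma fv_subfms: "\<psi> \<in> subfms \<phi> \<Longrightarrow> fv \<psi> \<subseteq> all_vars \<phi>"
proof -
  have "\<psi> \<in> subfms \<phi> \<Longrightarrow> all_vars \<psi> \<subseteq> all_vars \<phi>" by (induction \<phi>) auto
  then show "\<psi> \<in> subfms \<phi> \<Longrightarrow> fv \<psi> \<subseteq> all_vars \<phi>" using fv_subset_all_vars by blast
qed

lemma card_Un_le_add: "card A \<le> a \<Longrightarrow> card B \<le> b \<Longrightarrow> card (A \<union> B) \<le> a + b"
  by (rule order_trans[OF card_Un_le]) simp

lemma card_UN_set_le:
  assumes "\<And>t. card (f t) \<le> 1"
  shows "card (\<Union>t\<in>set ts. f t) \<le> length ts"
proof (induction ts)
  case (Cons t ts)
  show ?case using card_Un_le_add[OF assms Cons.IH, of t] by simp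
qed simp

lemma card_insert_le_Suc: "card A \<le> a \<Longrightarrow> card (insert x A) \<le> Suc a"
  by (metis Suc_le_mono card_insert_le_m1 card.infinite card_insert_disjoint finite_insert
      insert_absorb le_SucI zero_le)

lemma finite_subfms: "finite (subfms \<phi>)"
  by (induction \<phi>) auto

lemma finite_all_vars: "finite (all_vars \<phi>)"
  using finite_fv by (induction \<phi>) (auto simp del: fv.simps)

lemma finite_consts: "finite (consts_fm \<phi>)"
proof -
  have "finite (consts_trm t)" for t by (cases t) auto
  then show ?thesis by (induction \<phi>) auto
qed

lemma card_subfms_le: "card (subfms \<phi>) \<le> fm_length \<phi>"
proof (induction \<phi>)
  case (Rel R ts)
  then show ?case by simp
qed (auto intro: order_trans[OF card_insert_le_Suc[OF card_Un_le_add]]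
      order_trans[OF card_insert_le_Suc])

lemma card_all_vars_le: "card (all_vars \<phi>) \<le> fm_length \<phi>"
proof (induction \<phi>)
  case (Rel R ts)
  have "card (vars_trm t) \<le> 1" for t by (cases t) auto
  from card_UN_set_le[of vars_trm, OF this] show ?case by (simp add: le_add1 trans_le_add1)
next
  case (Eq s t)
  have "card (vars_trm t) \<le> 1" for t by (cases t) auto
  from card_Un_le_add[OF this[of s] this[of t]] show ?case by simp
qed (auto intro: order_trans[OF card_Un_le_add] order_trans[OF card_insert_le_Suc])

lemma card_consts_le: "card (consts_fm \<phi>) \<le> fm_length \<phi>"
proof (induction \<phi>)
  case (Rel R ts)
  have "card (consts_trm t) \<le> 1" for t by (cases t) auto
  from card_UN_set_le[of consts_trm, OF this] show ?case by (simp add: le_add1 trans_le_add1)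
next
  case (Eq s t)
  have "card (consts_trm t) \<le> 1" for t by (cases t) auto
  from card_Un_le_add[OF this[of s] this[of t]] show ?case by simp
qed (auto intro: order_trans[OF card_Un_le_add])


section \<open>Types of partial maps into the given model\<close>

text \<open>The values of \<open>t\<close> are numbered and \<open>r\<close> picks a preimage for
  each number; surplus numbers go to a fixed element, so that \<open>r\<close> always lands in
  \<open>D\<close>. This is how colours come to stand for types.\<close>

lemma ex_representatives:
  fixes t :: "'d \<Rightarrow> 'e"
  assumes "finite (t ` D)" "card (t ` D) \<le> M" "D \<noteq> {}"
  shows "\<exists>r::nat \<Rightarrow> 'd. (\<forall>c. r c \<in> D) \<and> (\<forall>d\<in>D. \<exists>c<M. t (r c) = t d)"
proof -
  obtain u where u: "bij_betw u {0..<card (t ` D)} (t ` D)"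
    using assms(1) ex_bij_betw_nat_finite by blast
  obtain d0 where d0: "d0 \<in> D" using assms(3) by blast
  define r where "r c = (if c < card (t ` D) then inv_into D t (u c) else d0)" for c
  have "r c \<in> D" for c
    using u d0 by (auto simp: r_def bij_betw_def intro!: inv_into_into)
  moreover have "\<exists>c<M. t (r c) = t d" if "d \<in> D" for d
  proof -
    have "t d \<in> u ` {0..<card (t ` D)}" using u that by (simp add: bij_betw_def)
    then obtain c where c: "c < card (t ` D)" "u c = t d" by auto
    then have "t (r c) = t d" using that by (simp add: r_def f_inv_into_f)
    then show ?thesis using c assms(2) by (meson less_le_trans)
  qed
  ultimately show ?thesis by blast
qed

text \<open>
  Elements below \<open>N\<close> of the model to be built are ordinary; the constant symbol \<open>c\<close> is
  interpreted by \<open>N + c\<close>. A map \<open>h\<close> on ordinary elements thus has a canonical extension to all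
  elements.
\<close>

locale type_space =
  fixes A :: "'a struct" and F :: "fm set" and C :: "nat set" and N :: nat
  assumes finite_C: "finite C"
    and univ_nonempty: "universe A \<noteq> {}"
    and const_in_univ: "const_of A c \<in> universe A"
begin

definition K :: "nat set" where "K = (+) N ` C"

definition extend :: "(nat \<Rightarrow> 'a) \<Rightarrow> nat \<Rightarrow> 'a" where
  "extend h i = (if i < N then h i else const_of A (i - N))"

text \<open>Equality of the \<open>F\<close>-types of two maps, with the elements of
  \<open>S\<close> and the constants as parameters.\<close>

definition agree :: "nat set \<Rightarrow> (nat \<Rightarrow> 'a) \<Rightarrow> (nat \<Rightarrow> 'a) \<Rightarrow> bool" where
  "agree S h h' \<longleftrightarrow> (\<forall>\<psi>\<in>F. \<forall>e. e ` fv \<psi> \<subseteq> S \<union> K \<longrightarrow>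
     sat A (extend h \<circ> e) \<psi> = sat A (extend h' \<circ> e) \<psi>)"

lemma K_ge: "i \<in> K \<Longrightarrow> \<not> i < N"
  by (auto simp: K_def)

lemma agree_sym: "agree S h h' \<Longrightarrow> agree S h' h"
  by (auto simp: agree_def)

lemma agree_trans: "agree S h h' \<Longrightarrow> agree S h' h'' \<Longrightarrow> agree S h h''"
  by (auto simp: agree_def)

lemma agree_mono: "agree S h h' \<Longrightarrow> T \<subseteq> S \<Longrightarrow> agree T h h'"
  unfolding agree_def by (meson Un_mono order_refl subset_trans)

lemma agreeD: "agree S h h' \<Longrightarrow> \<psi> \<in> F \<Longrightarrow> e ` fv \<psi> \<subseteq> S \<union> K \<Longrightarrow>
    sat A (extend h \<circ> e) \<psi> = sat A (extend h' \<circ> e) \<psi>"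
  by (auto simp: agree_def)

lemma agree_if_eq_on:
  assumes "\<And>i. i \<in> S \<Longrightarrow> h i = h' i"
  shows "agree S h h'"
  unfolding agree_def
proof (intro ballI allI impI sat_cong)
  fix \<psi> e x assume "e ` fv \<psi> \<subseteq> S \<union> K" "x \<in> fv \<psi>"
  then show "(extend h \<circ> e) x = (extend h' \<circ> e) x"
    using assms K_ge by (auto simp: extend_def)
qed

lemma extend_in_univ: "range h \<subseteq> universe A \<Longrightarrow> extend h i \<in> universe A"
  using const_in_univ by (auto simp: extend_def)

text \<open>
  The type over \<open>S\<close> of a map \<open>h\<close> together with one further point \<open>a\<close>, which is represented by
  \<open>None\<close> so that the type does not depend on the element of the new model mapped to \<open>a\<close>.
\<close>

definition pointed_type ::
    "var set \<Rightarrow> nat set \<Rightarrow> (nat \<Rightarrow> 'a) \<times> 'a \<Rightarrow> (fm \<times> (var \<Rightarrow> nat option)) set" where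
  "pointed_type V S = (\<lambda>(h, a). {(\<psi>, \<sigma>). \<psi> \<in> F \<and> \<sigma> \<in> PiE V (\<lambda>_. insert None (Some ` (S \<union> K))) \<and>
     sat A (\<lambda>x. case \<sigma> x of None \<Rightarrow> a | Some i \<Rightarrow> extend h i) \<psi>})"

text \<open>Since \<open>b\<close> lies neither in \<open>S\<close> nor in \<open>K\<close>,
  replacing \<open>b\<close> by \<open>None\<close> turns assignments into
  \<open>insert b S \<union> K\<close> into those of \<open>pointed_type\<close>. The type itself
  never mentions \<open>b\<close>, which is why any fresh \<open>b\<close> will do.\<close>

lemma pointed_type_eq_agree_insert:
  assumes V: "\<And>\<psi>. \<psi> \<in> F \<Longrightarrow> fv \<psi> \<subseteq> V"
    and eq: "pointed_type V S (h, a) = pointed_type V S (h', a')" and b: "b < N" "b \<notin> S"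
  shows "agree (insert b S) (h(b := a)) (h'(b := a'))"
  unfolding agree_def
proof (intro ballI allI impI)
  fix \<psi> e assume \<psi>: "\<psi> \<in> F" and e: "e ` fv \<psi> \<subseteq> insert b S \<union> K"
  define \<sigma> where "\<sigma> = restrict (\<lambda>x. if x \<in> fv \<psi> \<and> e x \<noteq> b then Some (e x) else None) V"
  have \<sigma>: "\<sigma> \<in> PiE V (\<lambda>_. insert None (Some ` (S \<union> K)))"
    unfolding \<sigma>_def using e by (intro restrict_PiE_iff[THEN iffD2] ballI) auto
  have *: "(extend (h(b := a)) \<circ> e) x = (case \<sigma> x of None \<Rightarrow> a | Some i \<Rightarrow> extend h i)"
    if "x \<in> fv \<psi>" for x h a
    using V[OF \<psi>] that b by (auto simp: \<sigma>_def extend_def)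
  have "sat A (extend (h(b := a)) \<circ> e) \<psi> \<longleftrightarrow> (\<psi>, \<sigma>) \<in> pointed_type V S (h, a)" for h a
  proof -
    have "sat A (extend (h(b := a)) \<circ> e) \<psi> \<longleftrightarrow> sat A (\<lambda>x. case \<sigma> x of None \<Rightarrow> a | Some i \<Rightarrow> extend h i) \<psi>"
      using * by (intro sat_cong ballI)
    then show ?thesis using \<psi> \<sigma> by (simp add: pointed_type_def)
  qed
  then show "sat A (extend (h(b := a)) \<circ> e) \<psi> = sat A (extend (h'(b := a')) \<circ> e) \<psi>"
    using eq by simp
qed

lemma pointed_type_eq_agree:
  assumes V: "\<And>\<psi>. \<psi> \<in> F \<Longrightarrow> fv \<psi> \<subseteq> V"
    and eq: "pointed_type V S (h, a) = pointed_type V S (h', a')"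
  shows "agree S h h'"
  unfolding agree_def
proof (intro ballI allI impI)
  fix \<psi> e assume \<psi>: "\<psi> \<in> F" and e: "e ` fv \<psi> \<subseteq> S \<union> K"
  define \<sigma> where "\<sigma> = restrict (\<lambda>x. if x \<in> fv \<psi> then Some (e x) else None) V"
  have \<sigma>: "\<sigma> \<in> PiE V (\<lambda>_. insert None (Some ` (S \<union> K)))"
    unfolding \<sigma>_def using e by (intro restrict_PiE_iff[THEN iffD2] ballI) auto
  have *: "(extend h \<circ> e) x = (case \<sigma> x of None \<Rightarrow> a | Some i \<Rightarrow> extend h i)"
    if "x \<in> fv \<psi>" for x h a
    using V[OF \<psi>] that by (auto simp: \<sigma>_def)
  have "sat A (extend h \<circ> e) \<psi> \<longleftrightarrow> (\<psi>, \<sigma>) \<in> pointed_type V S (h, a)" for h a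
  proof -
    have "sat A (extend h \<circ> e) \<psi> \<longleftrightarrow> sat A (\<lambda>x. case \<sigma> x of None \<Rightarrow> a | Some i \<Rightarrow> extend h i) \<psi>"
      using * by (intro sat_cong ballI)
    then show ?thesis using \<psi> \<sigma> by (simp add: pointed_type_def)
  qed
  from this[of h a] this[of h' a'] show "sat A (extend h \<circ> e) \<psi> = sat A (extend h' \<circ> e) \<psi>"
    using eq by simp
qed

text \<open>A type is a set of pairs of a formula and an assignment of \<open>V\<close> into
  \<open>S\<close>, the constants and the extra point.\<close>

lemma card_pointed_types:
  assumes "finite F" "finite V" "finite S"
  shows "finite (pointed_type V S ` D)"
    and "card (pointed_type V S ` D) \<le> 2 ^ (card F * (card S + card C + 1) ^ card V)"
proof -
  define W where "W = insert None (Some ` (S \<union> K))"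
  define Z where "Z = F \<times> PiE V (\<lambda>_. W)"
  have finK: "finite K" using finite_C by (simp add: K_def)
  have finZ: "finite Z" using assms finK by (auto simp: Z_def W_def intro!: finite_PiE)
  have sub: "pointed_type V S ` D \<subseteq> Pow Z" by (auto simp: pointed_type_def Z_def W_def)
  then show "finite (pointed_type V S ` D)" using finZ by (meson finite_Pow_iff finite_subset)
  have "card K \<le> card C" unfolding K_def using finite_C by (rule card_image_le)
  then have "card W \<le> card S + card C + 1"
    unfolding W_def using card_Un_le[of S K] assms finK by (simp add: card_image card_insert_if)
  then have "card Z \<le> card F * (card S + card C + 1) ^ card V"
    using assms by (simp add: Z_def card_cartesian_product card_PiE power_mono)
  moreover have "card (pointed_type V S ` D) \<le> 2 ^ card Z"
    using card_mono[OF _ sub] finZ by (simp add: card_Pow)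
  ultimately show "card (pointed_type V S ` D) \<le> 2 ^ (card F * (card S + card C + 1) ^ card V)"
    by (meson one_le_numeral order_trans power_increasing)
qed

text \<open>A request \<open>(h, a)\<close> over \<open>S\<close> matters only up to its pointed
  type, so \<open>M\<close> indices cover all requests over one base. A colour \<open>c\<close> at
  \<open>T\<close> stands for the map \<open>fst (rep T c)\<close>, and
  \<open>ex_extension_coloring\<close> gives a colouring \<open>f\<close> whose decoded maps
  \<open>d\<close> copy every request at some \<open>b\<close>. The bound \<open>card S < k\<close>
  leaves room for \<open>b\<close>: the sets \<open>insert b T\<close> still have size at most
  \<open>k\<close>, where the representatives cover all types.\<close>

lemma ex_proposals:
  fixes k M :: nat
  assumes fin: "finite F" "finite V" and V: "\<And>\<psi>. \<psi> \<in> F \<Longrightarrow> fv \<psi> \<subseteq> V"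
    and M: "2 ^ (card F * (k + card C + 1) ^ card V) \<le> M"
    and small: "real M * real (N + 1) ^ k * (1 - 1 / real M ^ 2 ^ k) ^ (N - k) < 1"
  shows "\<exists>d. \<forall>S h a. S \<subseteq> {..<N} \<longrightarrow> card S < k \<longrightarrow> range h \<subseteq> universe A \<longrightarrow> a \<in> universe A \<longrightarrow>
    (\<exists>b<N. b \<notin> S \<and> (\<forall>T\<subseteq>S. range (d (insert b T)) \<subseteq> universe A \<and>
       agree (insert b T) (d (insert b T)) (h(b := a))))"
proof -
  have M0: "M > 0" using M by (metis gr_zeroI le_zero_eq power_not_zero zero_neq_numeral)
  define D :: "((nat \<Rightarrow> 'a) \<times> 'a) set" where "D = {h. range h \<subseteq> universe A} \<times> universe A"
  obtain a0 where a0: "a0 \<in> universe A" using univ_nonempty by blast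
  then have "((\<lambda>_. a0), a0) \<in> D" by (auto simp: D_def)
  then have D: "D \<noteq> {}" by blast
  have "\<exists>r::nat \<Rightarrow> _. (\<forall>c. r c \<in> D) \<and>
      (S \<subseteq> {..<N} \<longrightarrow> card S \<le> k \<longrightarrow> (\<forall>d\<in>D. \<exists>c<M. pointed_type V S (r c) = pointed_type V S d))" for S
  proof (cases "S \<subseteq> {..<N} \<and> card S \<le> k")
    case True
    then have finS: "finite S" using finite_subset by blast
    have "card F * (card S + card C + 1) ^ card V \<le> card F * (k + card C + 1) ^ card V"
      using True by (intro mult_left_mono power_mono) auto
    then have "2 ^ (card F * (card S + card C + 1) ^ card V) \<le> M"
      using M by (meson one_le_numeral order_trans power_increasing)
    then have "card (pointed_type V S ` D) \<le> M"
      using card_pointed_types(2)[OF fin finS] by (meson order_trans)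
    from ex_representatives[OF card_pointed_types(1)[OF fin finS] this D] show ?thesis by blast
  next
    case False
    then show ?thesis using D by (intro exI[of _ "\<lambda>_. SOME d. d \<in> D"]) (auto simp: some_in_eq)
  qed
  then obtain rep :: "nat set \<Rightarrow> nat \<Rightarrow> _" where rep: "\<And>S c. rep S c \<in> D"
    "\<And>S d. S \<subseteq> {..<N} \<Longrightarrow> card S \<le> k \<Longrightarrow> d \<in> D \<Longrightarrow> \<exists>c<M. pointed_type V S (rep S c) = pointed_type V S d"
    by metis
  \<comment> \<open>The colour naming a map equivalent to \<open>h\<close> over \<open>S\<close>;
    the default 0 keeps it below \<open>M\<close>.\<close>
  define col where "col S h = (if \<exists>c<M. agree S (fst (rep S c)) h
    then SOME c. c < M \<and> agree S (fst (rep S c)) h else 0)" for S h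
  have col: "col S h < M \<and> agree S (fst (rep S (col S h))) h" if "\<exists>c<M. agree S (fst (rep S c)) h" for S h
    using someI_ex[OF that] that by (simp add: col_def)
  have col_less: "col S h < M" for S h
    using col[of S h] M0 by (cases "\<exists>c<M. agree S (fst (rep S c)) h") (auto simp: col_def)
  \<comment> \<open>The request with index \<open>p\<close>, its extra point placed at
    \<open>b\<close>.\<close>
  define pt where "pt S p b = (fst (rep S p))(b := snd (rep S p))" for S p b
  obtain f where f: "\<And>S p. S \<subseteq> {..<N} \<Longrightarrow> card S \<le> k \<Longrightarrow> p < M \<Longrightarrow>
      \<exists>b<N. b \<notin> S \<and> (\<forall>T\<subseteq>S. f (insert b T) = col (insert b T) (pt S p b))"
    using ex_extension_coloring[of "\<lambda>S p b T. col T (pt S p b)", OF col_less small] by blast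
  define d where "d T = fst (rep T (f T))" for T
  have range_d: "range (d T) \<subseteq> universe A" for T
    using rep(1)[of T "f T"] by (auto simp: d_def D_def)
  have "\<exists>b<N. b \<notin> S \<and> (\<forall>T\<subseteq>S. agree (insert b T) (d (insert b T)) (h(b := a)))"
    if S: "S \<subseteq> {..<N}" "card S < k" and h: "range h \<subseteq> universe A" "a \<in> universe A" for S h a
  proof -
    have finS: "finite S" using S finite_subset by blast
    obtain p where p: "p < M" "pointed_type V S (rep S p) = pointed_type V S (h, a)"
      using rep(2)[of S "(h, a)"] S h by (auto simp: D_def)
    obtain b where b: "b < N" "b \<notin> S" "\<And>T. T \<subseteq> S \<Longrightarrow> f (insert b T) = col (insert b T) (pt S p b)"
      using f[of S p] S p by auto
    have pt: "agree (insert b S) (pt S p b) (h(b := a))"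
      unfolding pt_def using pointed_type_eq_agree_insert[OF V _ b(1,2)] p(2) by (metis prod.collapse)
    have "agree (insert b T) (d (insert b T)) (h(b := a))" if T: "T \<subseteq> S" for T
    proof -
      define T' where "T' = insert b T"
      have T': "T' \<subseteq> {..<N}" using T S b by (auto simp: T'_def)
      have "card T \<le> card S" using T finS by (rule card_mono[rotated])
      then have "card T' \<le> k" unfolding T'_def using S(2) card_insert_le_Suc[of T "card S" b] by simp
      \<comment> \<open>\<open>a0\<close> is a dummy point: only agreement over \<open>T'\<close> is
        wanted, and \<open>b\<close> already belongs to \<open>T'\<close>.\<close>
      moreover have "(pt S p b, a0) \<in> D"
        using rep(1)[of S p] a0 by (auto simp: D_def pt_def)
      ultimately obtain c where c: "c < M" "pointed_type V T' (rep T' c) = pointed_type V T' (pt S p b, a0)"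
        using rep(2)[OF T'] by blast
      have "agree T' (fst (rep T' c)) (pt S p b)"
        using pointed_type_eq_agree[OF V] c(2) by (metis prod.collapse)
      then have "agree T' (d T') (pt S p b)"
        unfolding d_def using b(3)[OF T] col[of T' "pt S p b"] c(1) by (auto simp: T'_def)
      moreover have "agree T' (pt S p b) (h(b := a))"
        using T by (intro agree_mono[OF pt]) (auto simp: T'_def)
      ultimately show ?thesis unfolding T'_def by (rule agree_trans)
    qed
    then show ?thesis using b by blast
  qed
  with range_d show ?thesis by (intro exI[of _ d]) simp
qed

end


section \<open>The random model\<close>

text \<open>\<open>proposal\<close> is all that is kept of the random choice; from here on the
  construction is deterministic. One \<open>b\<close> must serve all \<open>T \<subseteq> S\<close>
  at once, because the map of \<open>insert b S\<close> is constrained by those of all its proper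
  subsets.\<close>

locale proposals = type_space A F C N
  for A :: "'a struct" and F :: "fm set" and C :: "nat set" and N :: nat +
  fixes k :: nat and d :: "nat set \<Rightarrow> nat \<Rightarrow> 'a"
  assumes k_ge_2: "2 \<le> k" and N_pos: "0 < N"
    and proposal: "\<And>S h a. S \<subseteq> {..<N} \<Longrightarrow> card S < k \<Longrightarrow> range h \<subseteq> universe A \<Longrightarrow> a \<in> universe A \<Longrightarrow>
      \<exists>b<N. b \<notin> S \<and> (\<forall>T\<subseteq>S. range (d (insert b T)) \<subseteq> universe A \<and>
        agree (insert b T) (d (insert b T)) (h(b := a)))"
begin

section \<open>Live sets and their maps, by recursion over proper subsets\<close>

definition candidate :: "(nat set \<Rightarrow> (nat \<Rightarrow> 'a) option) \<Rightarrow> nat set \<Rightarrow> (nat \<Rightarrow> 'a) \<Rightarrow> bool" where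
  "candidate G S h \<longleftrightarrow>
     range h \<subseteq> universe A \<and> (\<forall>T. T \<subset> S \<longrightarrow> (\<exists>h'. G T = Some h' \<and> agree T h h'))"

text \<open>\<open>None\<close> means dead. Preferring \<open>d S\<close> lets the proposals take
  effect; the fallback to an arbitrary candidate makes liveness depend only on the existence of a
  candidate, not on whether the proposal happens to fit.\<close>

definition choose_map ::
    "(nat set \<Rightarrow> (nat \<Rightarrow> 'a) option) \<Rightarrow> nat set \<Rightarrow> (nat \<Rightarrow> 'a) option" where
  "choose_map G S =
     (if finite S \<and> S \<subseteq> {..<N} \<and> card S \<le> k \<and> (\<exists>h. candidate G S h)
      then Some (if candidate G S (d S) then d S else SOME h. candidate G S h) else None)"

definition H :: "nat set \<Rightarrow> (nat \<Rightarrow> 'a) option" where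
  "H = wfrec finite_psubset choose_map"

definition live :: "nat set \<Rightarrow> bool" where "live S \<longleftrightarrow> H S \<noteq> None"

definition hmap :: "nat set \<Rightarrow> nat \<Rightarrow> 'a" where "hmap S = the (H S)"

lemma H_rec: "H S = choose_map H S"
proof -
  have "H S = choose_map (cut H finite_psubset S) S"
    unfolding H_def by (rule wfrec[OF wf_finite_psubset])
  also have "\<dots> = choose_map H S"
  proof (cases "finite S")
    case True
    then have "cut H finite_psubset S T = H T" if "T \<subset> S" for T
      using that by (simp add: cut_apply)
    then have "candidate (cut H finite_psubset S) S = candidate H S"
      by (auto simp: candidate_def fun_eq_iff)
    then show ?thesis by (simp add: choose_map_def)
  qed (simp add: choose_map_def)
  finally show ?thesis .
qed

lemma candidate_alt:
  "candidate H S h \<longleftrightarrow> range h \<subseteq> universe A \<and> (\<forall>T. T \<subset> S \<longrightarrow> live T \<and> agree T h (hmap T))"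
proof -
  have "(\<exists>h'. H T = Some h' \<and> agree T h h') \<longleftrightarrow> live T \<and> agree T h (hmap T)" for T
    by (auto simp: live_def hmap_def)
  then show ?thesis by (simp add: candidate_def)
qed

lemma live_candidate:
  assumes "live S"
  shows "candidate H S (hmap S)" "S \<subseteq> {..<N}" "card S \<le> k"
proof -
  have *: "S \<subseteq> {..<N} \<and> card S \<le> k \<and> (\<exists>h. candidate H S h)"
    "H S = Some (if candidate H S (d S) then d S else SOME h. candidate H S h)"
    using assms H_rec[of S] unfolding live_def choose_map_def by (auto split: if_splits)
  show "candidate H S (hmap S)"
    unfolding hmap_def using * someI_ex[of "candidate H S"] by simp
  show "S \<subseteq> {..<N}" "card S \<le> k" using * by auto
qed

lemma live_subset: "live S \<Longrightarrow> T \<subseteq> S \<Longrightarrow> live T"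
  using live_candidate(1)[of S, unfolded candidate_alt] by (cases "T = S") simp_all

lemma hmap_agree: "live S \<Longrightarrow> T \<subseteq> S \<Longrightarrow> agree T (hmap S) (hmap T)"
  using live_candidate(1)[of S, unfolded candidate_alt]
  by (cases "T = S") (simp_all add: agree_if_eq_on)

lemma range_hmap: "live S \<Longrightarrow> range (hmap S) \<subseteq> universe A"
  using live_candidate(1)[of S, unfolded candidate_alt] by simp

lemma live_if_candidate:
  assumes "S \<subseteq> {..<N}" "card S \<le> k" "candidate H S h"
  shows "live S" and "candidate H S (d S) \<Longrightarrow> hmap S = d S"
proof -
  have "finite S" using assms(1) finite_subset by blast
  then have "H S = Some (if candidate H S (d S) then d S else SOME h. candidate H S h)"
    using assms unfolding H_rec[of S] choose_map_def by auto
  then show "live S" "candidate H S (d S) \<Longrightarrow> hmap S = d S" by (auto simp: live_def hmap_def)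
qed

lemma live_empty: "live {}"
proof -
  obtain a where "a \<in> universe A" using univ_nonempty by blast
  then have "candidate H {} (\<lambda>_. a)" by (auto simp: candidate_def)
  from live_if_candidate(1)[OF _ _ this] show ?thesis by simp
qed

lemma live_singleton: "i < N \<Longrightarrow> live {i}"
proof -
  assume i: "i < N"
  have "candidate H {i} (hmap {})"
    unfolding candidate_alt using live_empty range_hmap
    by (auto simp: psubset_eq subset_singleton_iff intro: agree_if_eq_on)
  from live_if_candidate(1)[OF _ _ this] show ?thesis using i k_ge_2 by simp
qed

text \<open>
  Without equality any two realised 1-types are jointly realised, so every pair is live: this
  is what makes unguarded quantification over pairs harmless.
\<close>

lemma live_pair:
  assumes "i < N" "j < N"
  shows "live {i, j}"
proof (cases "i = j")
  case True
  then show ?thesis using live_singleton assms by simp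
next
  case False
  define h where "h = (hmap {i})(j := hmap {j} j)"
  have "range h \<subseteq> universe A"
    using range_hmap[OF live_singleton] assms by (auto simp: h_def image_subset_iff)
  moreover have "live T \<and> agree T h (hmap T)" if "T \<subset> {i, j}" for T
  proof -
    have "T = {} \<or> T = {i} \<or> T = {j}" using that by blast
    then show ?thesis
      using live_empty live_singleton assms False by (auto simp: h_def intro!: agree_if_eq_on)
  qed
  ultimately have "candidate H {i, j} h" by (simp add: candidate_alt)
  from live_if_candidate(1)[OF _ _ this] show ?thesis using assms k_ge_2 False by simp
qed

lemma live_card_le_2:
  assumes "S \<subseteq> {..<N}" "card S \<le> 2"
  shows "live S"
proof -
  have "finite S" using assms finite_subset by blast
  consider "card S = 0" | "card S = 1" | "card S = 2" using assms(2) by linarith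
  then show ?thesis
  proof cases
    case 1
    then show ?thesis using \<open>finite S\<close> live_empty by simp
  next
    case 2
    then show ?thesis using live_singleton assms(1) by (metis card_1_singletonE insert_subset lessThan_iff)
  next
    case 3
    then show ?thesis using live_pair assms(1) by (metis card_2_iff insert_subset lessThan_iff)
  qed
qed

text \<open>By induction on \<open>T \<subseteq> S\<close> the map of \<open>insert b T\<close> is
  the proposal \<open>d (insert b T)\<close>: a proper subset either contains \<open>b\<close> and
  is settled by induction, or lies in \<open>S\<close>, where \<open>hmap S\<close> agrees with the
  map of that subset. So each proposal is a candidate and the recursion takes it.\<close>

lemma live_extension:
  assumes S: "live S" "card S < k" and a: "a \<in> universe A"
  shows "\<exists>b<N. b \<notin> S \<and> live (insert b S) \<and> agree (insert b S) (hmap (insert b S)) ((hmap S)(b := a))"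
proof -
  have SN: "S \<subseteq> {..<N}" using live_candidate[OF S(1)] by blast
  then have finS: "finite S" using finite_subset by blast
  from proposal[OF SN S(2) range_hmap[OF S(1)] a]
  obtain b where *: "b < N \<and> b \<notin> S \<and> (\<forall>T\<subseteq>S. range (d (insert b T)) \<subseteq> universe A \<and>
      agree (insert b T) (d (insert b T)) ((hmap S)(b := a)))"
    by (rule exE)
  then have b: "b < N" "b \<notin> S" by simp_all
  have d: "range (d (insert b T)) \<subseteq> universe A"
      "agree (insert b T) (d (insert b T)) ((hmap S)(b := a))" if "T \<subseteq> S" for T
    using * that by simp_all
  \<comment> \<open>The common target: all maps in the induction are compared with \<open>h\<close>,
    and agreement between them follows by transitivity.\<close>
  define h where "h = (hmap S)(b := a)"
  note d = d[folded h_def]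
  have "live (insert b T) \<and> agree (insert b T) (hmap (insert b T)) h"
    if "finite T" "T \<subseteq> S" for T
    using that
  proof (induction T rule: finite_psubset_induct)
    case (psubset T)
    have "candidate H (insert b T) (d (insert b T))"
      unfolding candidate_alt
    proof (intro conjI allI impI)
      fix T' assume T': "T' \<subset> insert b T"
      have dT': "agree T' (d (insert b T)) h"
        using T' by (intro agree_mono[OF d(2)[OF psubset.prems]]) (rule psubset_imp_subset)
      have "live T' \<and> agree T' (hmap T') h"
      proof (cases "b \<in> T'")
        case True
        then have eq: "T' = insert b (T' - {b})" by blast
        have "T' - {b} \<subset> T" using T' True b(2) psubset.prems by blast
        moreover from this have "T' - {b} \<subseteq> S" using psubset.prems by blast
        ultimately show ?thesis using psubset.IH[of "T' - {b}", folded eq] by blast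
      next
        case False
        then have sub: "T' \<subseteq> S" using T' psubset.prems by blast
        have "agree T' (hmap S) h" using False by (intro agree_if_eq_on) (auto simp: h_def)
        then show ?thesis
          using live_subset[OF S(1) sub] agree_trans[OF agree_sym[OF hmap_agree[OF S(1) sub]]] by simp
      qed
      then show "live T'" "agree T' (d (insert b T)) (hmap T')"
        using agree_trans[OF dT'] agree_sym[of T' "hmap T'"] by simp_all
    qed (use d(1)[OF psubset.prems] in auto)
    moreover have "card (insert b T) \<le> k"
      using card_mono[OF finS psubset.prems] S(2) card_insert_le_Suc[of T "card S" b] by simp
    moreover have "insert b T \<subseteq> {..<N}" using b psubset.prems SN by auto
    ultimately have "live (insert b T)" "hmap (insert b T) = d (insert b T)"
      using live_if_candidate[of "insert b T" "d (insert b T)"] by simp_all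
    then show ?case using d(2)[OF psubset.prems] by simp
  qed
  from this[OF finS order_refl] show ?thesis using b unfolding h_def by blast
qed

section \<open>The finite structure and its truth lemma\<close>

definition ordinary :: "nat set \<Rightarrow> nat set" where "ordinary S = S \<inter> {..<N}"

lemma ordinary_cover:
  assumes "X \<subseteq> S \<union> K" "S \<subseteq> {..<N}"
  shows "ordinary X \<subseteq> S" "X \<subseteq> ordinary X \<union> K"
proof -
  show "ordinary X \<subseteq> S" using assms(1) K_ge unfolding ordinary_def by blast
  show "X \<subseteq> ordinary X \<union> K" using assms unfolding ordinary_def by blast
qed

text \<open>The exact set of ordinary entries of a tuple decides its atoms; for atoms in
  \<open>F\<close>, \<open>hmap_agree\<close> makes every larger live set give the same answer.
  Constants in \<open>C\<close> get elements of their own, all others the element 0, which exists by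
  \<open>N_pos\<close>.\<close>

definition B :: "nat struct" where
  "B = \<lparr>universe = {..<N} \<union> K,
     rel_of = (\<lambda>R. {as. set as \<subseteq> {..<N} \<union> K \<and> live (ordinary (set as)) \<and>
       map (extend (hmap (ordinary (set as)))) as \<in> rel_of A R}),
     const_of = (\<lambda>c. if c \<in> C then N + c else 0)\<rparr>"

lemma map_val_B:
  assumes "consts_fm (Rel R ts) \<subseteq> C"
  shows "ordinary (set (map (val B e) ts)) = ordinary (e ` fv (Rel R ts))"
    and "map (extend h) (map (val B e) ts) = map (val A (extend h \<circ> e)) ts"
    and "set (map (val B e) ts) \<subseteq> {..<N} \<union> K \<longleftrightarrow> e ` fv (Rel R ts) \<subseteq> {..<N} \<union> K"
proof -
  have c: "const_of B c = N + c" "N + c \<in> K" if "Const c \<in> set ts" for c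
    using that assms by (force simp: B_def K_def)+
  have "extend h (val B e t) = val A (extend h \<circ> e) t" if "t \<in> set ts" for t
    using that c by (cases t rule: trm.exhaust) (simp_all add: extend_def)
  then show "map (extend h) (map (val B e) ts) = map (val A (extend h \<circ> e)) ts" by simp
  \<comment> \<open>Constants in \<open>C\<close> contribute only elements of \<open>K\<close>, so
    up to \<open>K\<close> the entries are the values of the variables, and \<open>ordinary\<close>
    does not see \<open>K\<close>.\<close>
  have eq: "set (map (val B e) ts) \<union> K = e ` fv (Rel R ts) \<union> K"
  proof -
    have "val B e t \<in> e ` fv (Rel R ts) \<union> K" if "t \<in> set ts" for t
      using that c by (cases t rule: trm.exhaust) (auto intro!: imageI bexI[of _ t])
    moreover have "e x \<in> set (map (val B e) ts)" if "x \<in> fv (Rel R ts)" for x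
      using Var_in_if_fv_Rel[OF that] by force
    ultimately show ?thesis by auto
  qed
  have "ordinary X = ordinary (X \<union> K)" for X using K_ge by (auto simp: ordinary_def)
  then show "ordinary (set (map (val B e) ts)) = ordinary (e ` fv (Rel R ts))" using eq by metis
  have "X \<subseteq> {..<N} \<union> K \<longleftrightarrow> X \<union> K \<subseteq> {..<N} \<union> K" for X by auto
  then show "set (map (val B e) ts) \<subseteq> {..<N} \<union> K \<longleftrightarrow> e ` fv (Rel R ts) \<subseteq> {..<N} \<union> K"
    using eq by metis
qed

lemma sat_B_Rel:
  assumes "consts_fm (Rel R ts) \<subseteq> C"
  shows "sat B e (Rel R ts) \<longleftrightarrow> e ` fv (Rel R ts) \<subseteq> {..<N} \<union> K \<and>
    live (ordinary (e ` fv (Rel R ts))) \<and>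
    sat A (extend (hmap (ordinary (e ` fv (Rel R ts)))) \<circ> e) (Rel R ts)"
proof -
  have "sat B e (Rel R ts) \<longleftrightarrow> set (map (val B e) ts) \<subseteq> {..<N} \<union> K \<and>
    live (ordinary (set (map (val B e) ts))) \<and>
    map (extend (hmap (ordinary (set (map (val B e) ts))))) (map (val B e) ts) \<in> rel_of A R"
    by (simp add: B_def)
  then show ?thesis unfolding map_val_B[OF assms] by simp
qed

text \<open>Arbitrary constants are allowed, since \<open>sat_ex_guarded\<close> delivers guards
  without control of their constants. These can only enlarge the set of entries, and subsets of live
  sets are live.\<close>

lemma sat_B_Rel_live: "sat B e (Rel R ts) \<Longrightarrow> live (ordinary (e ` fv (Rel R ts)))"
proof -
  assume "sat B e (Rel R ts)"
  then have "live (ordinary (set (map (val B e) ts)))" by (simp add: B_def)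
  moreover have "e x \<in> set (map (val B e) ts)" if "x \<in> fv (Rel R ts)" for x
    using Var_in_if_fv_Rel[OF that] by force
  then have "ordinary (e ` fv (Rel R ts)) \<subseteq> ordinary (set (map (val B e) ts))"
    by (auto simp: ordinary_def)
  ultimately show ?thesis using live_subset by blast
qed

lemma live_ordinary_image:
  assumes "card (fv \<chi>) \<le> 2"
  shows "live (ordinary (e ` fv \<chi>))"
proof (rule live_card_le_2)
  have "card (ordinary (e ` fv \<chi>)) \<le> card (e ` fv \<chi>)"
    unfolding ordinary_def using finite_fv by (intro card_mono) auto
  also have "\<dots> \<le> card (fv \<chi>)" using finite_fv by (rule card_image_le)
  finally show "card (ordinary (e ` fv \<chi>)) \<le> 2" using assms by simp
qed (simp add: ordinary_def)

text \<open>One argument for both quantifiers: \<open>v = True\<close> transfers witnesses,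
  \<open>v = False\<close> counterexamples. From \<open>B\<close> to \<open>A\<close>,
  \<open>guard\<close> provides a live set for the new assignment, and its map sends
  \<open>b\<close> to the element sought; from \<open>A\<close> to \<open>B\<close>,
  \<open>live_extension\<close> copies that element to a fresh \<open>b\<close>.\<close>

lemma quantifier_transfer:
  assumes IH: "\<And>e S. live S \<Longrightarrow> e ` fv \<chi> \<subseteq> S \<union> K \<Longrightarrow> sat B e \<chi> \<longleftrightarrow> sat A (extend (hmap S) \<circ> e) \<chi>"
    and S: "live S" "e ` (fv \<chi> - {x}) \<subseteq> S \<union> K"
    and small: "card (fv \<chi> - {x}) < k" and \<chi>: "\<chi> \<in> F"
    and inv: "\<And>T h h'. agree T h h' \<Longrightarrow> e ` (fv \<chi> - {x}) \<subseteq> T \<union> K \<Longrightarrow>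
      (\<exists>a\<in>universe A. sat A ((extend h \<circ> e)(x := a)) \<chi> = v) =
      (\<exists>a\<in>universe A. sat A ((extend h' \<circ> e)(x := a)) \<chi> = v)"
    and guard: "\<And>b. b \<in> universe B \<Longrightarrow> sat B (e(x := b)) \<chi> = v \<Longrightarrow> live (ordinary (e(x := b) ` fv \<chi>))"
  shows "(\<exists>b\<in>universe B. sat B (e(x := b)) \<chi> = v) =
    (\<exists>a\<in>universe A. sat A ((extend (hmap S) \<circ> e)(x := a)) \<chi> = v)"
proof -
  \<comment> \<open>Shrinking \<open>S\<close> to the ordinary elements that \<open>e\<close> really
    uses brings the size below \<open>k\<close>, so that one more element fits, and also gives a
    subset of the set \<open>S'\<close> below.\<close>
  define T where "T = ordinary (e ` (fv \<chi> - {x}))"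
  have "S \<subseteq> {..<N}" using live_candidate(2)[OF S(1)] .
  then have TS: "T \<subseteq> S" and eT: "e ` (fv \<chi> - {x}) \<subseteq> T \<union> K"
    using ordinary_cover[OF S(2)] by (simp_all add: T_def)
  have liveT: "live T" using live_subset[OF S(1) TS] .
  have univ: "universe B = {..<N} \<union> K" by (simp add: B_def)
  have ST: "(\<exists>a\<in>universe A. sat A ((extend (hmap S) \<circ> e)(x := a)) \<chi> = v) =
      (\<exists>a\<in>universe A. sat A ((extend (hmap T) \<circ> e)(x := a)) \<chi> = v)"
    using inv[OF hmap_agree[OF S(1) TS] eT] .
  show ?thesis unfolding ST
  proof
    assume "\<exists>b\<in>universe B. sat B (e(x := b)) \<chi> = v"
    then obtain b where b: "b \<in> universe B" "sat B (e(x := b)) \<chi> = v" by blast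
    define S' where "S' = ordinary (e(x := b) ` fv \<chi>)"
    have live': "live S'" using guard[OF b] by (simp add: S'_def)
    have "e(x := b) ` fv \<chi> \<subseteq> {..<N} \<union> K"
      using b(1) eT TS \<open>S \<subseteq> {..<N}\<close> unfolding univ by auto
    then have "e(x := b) ` fv \<chi> \<subseteq> S' \<union> K" unfolding S'_def by (rule ordinary_cover) simp
    then have "sat A (extend (hmap S') \<circ> e(x := b)) \<chi> = v" using IH[OF live'] b(2) by blast
    moreover have "extend (hmap S') \<circ> e(x := b) = (extend (hmap S') \<circ> e)(x := extend (hmap S') b)"
      by auto
    ultimately have "\<exists>a\<in>universe A. sat A ((extend (hmap S') \<circ> e)(x := a)) \<chi> = v"
      using extend_in_univ[OF range_hmap[OF live']] by metis
    \<comment> \<open>\<open>S\<close> and \<open>S'\<close> may be unrelated; their maps are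
      compared over the common subset \<open>T\<close>, where \<open>inv\<close> fixes the truth
      value of the quantified formula.\<close>
    moreover have "T \<subseteq> S'" by (auto simp: T_def S'_def ordinary_def)
    ultimately show "\<exists>a\<in>universe A. sat A ((extend (hmap T) \<circ> e)(x := a)) \<chi> = v"
      using inv[OF hmap_agree[OF live'] eT] by blast
  next
    assume "\<exists>a\<in>universe A. sat A ((extend (hmap T) \<circ> e)(x := a)) \<chi> = v"
    then obtain a where a: "a \<in> universe A" "sat A ((extend (hmap T) \<circ> e)(x := a)) \<chi> = v" by blast
    have finv: "finite (fv \<chi> - {x})" using finite_fv by blast
    have "card T \<le> card (e ` (fv \<chi> - {x}))"
      unfolding T_def ordinary_def using finv by (intro card_mono) auto
    also have "\<dots> \<le> card (fv \<chi> - {x})" using finv by (rule card_image_le)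
    finally have "card T < k" using small by simp
    then obtain b where b: "b < N" "b \<notin> T" "live (insert b T)"
        "agree (insert b T) (hmap (insert b T)) ((hmap T)(b := a))"
      using live_extension[OF liveT _ a(1)] by auto
    have eb: "e(x := b) ` fv \<chi> \<subseteq> insert b T \<union> K" using eT by auto
    \<comment> \<open>As \<open>b\<close> avoids both \<open>T\<close> and \<open>K\<close>, no
      other free variable has the value \<open>b\<close>, so redirecting \<open>b\<close> to
      \<open>a\<close> disturbs nothing else.\<close>
    have eq: "((extend (hmap T) \<circ> e)(x := a)) y = (extend ((hmap T)(b := a)) \<circ> e(x := b)) y"
      if "y \<in> fv \<chi>" for y
    proof (cases "y = x")
      case False
      then have "e y \<in> T \<union> K" using that eT by blast
      then have "e y \<noteq> b" using b K_ge by blast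
      then show ?thesis using False by (simp add: extend_def)
    qed (use b in \<open>simp add: extend_def\<close>)
    have "sat A (extend ((hmap T)(b := a)) \<circ> e(x := b)) \<chi> = v"
      using a(2) sat_cong[of \<chi> "(extend (hmap T) \<circ> e)(x := a)"] eq by metis
    then have "sat A (extend (hmap (insert b T)) \<circ> e(x := b)) \<chi> = v"
      using agreeD[OF b(4) \<chi> eb] by simp
    then have "sat B (e(x := b)) \<chi> = v" using IH[OF b(3) eb] by simp
    then show "\<exists>b\<in>universe B. sat B (e(x := b)) \<chi> = v" using b(1) univ by blast
  qed
qed

text \<open>Any live \<open>S\<close> covering the assignment is allowed, so a binary connective can
  use one \<open>S\<close> for both parts. The bound on free variables gives
  \<open>live_extension\<close> room for one more element; true guards and the liveness of pairs
  supply the live sets that quantifiers need.\<close>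

lemma truth:
  assumes "triguarded \<psi>" "subfms \<psi> \<subseteq> F" "consts_fm \<psi> \<subseteq> C"
    and "\<And>\<theta>. \<theta> \<in> F \<Longrightarrow> card (fv \<theta>) < k"
    and "live S" "e ` fv \<psi> \<subseteq> S \<union> K"
  shows "sat B e \<psi> \<longleftrightarrow> sat A (extend (hmap S) \<circ> e) \<psi>"
  using assms(1-3,5,6)
proof (induction \<psi> arbitrary: e S)
  case (Rel R ts)
  define T where "T = ordinary (e ` fv (Rel R ts))"
  have SN: "S \<subseteq> {..<N}" using live_candidate(2)[OF Rel.prems(4)] .
  then have TS: "T \<subseteq> S" and eT: "e ` fv (Rel R ts) \<subseteq> T \<union> K"
    using ordinary_cover[OF Rel.prems(5)] unfolding T_def by simp_all
  have "sat B e (Rel R ts) \<longleftrightarrow> sat A (extend (hmap T) \<circ> e) (Rel R ts)"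
    using sat_B_Rel[OF Rel.prems(3), of e] live_subset[OF Rel.prems(4) TS] Rel.prems(5) SN
    unfolding T_def by blast
  also have "\<dots> \<longleftrightarrow> sat A (extend (hmap S) \<circ> e) (Rel R ts)"
    using agreeD[OF hmap_agree[OF Rel.prems(4) TS] _ eT] Rel.prems(2) by simp
  finally show ?case .
next
  case (Exists x \<chi>)
  have sub: "triguarded \<chi>" "subfms \<chi> \<subseteq> F" "consts_fm \<chi> \<subseteq> C"
    using Exists.prems by simp_all
  have F: "\<chi> \<in> F" "Exists x \<chi> \<in> F" using Exists.prems(2) subfms_refl[of \<chi>] by auto
  have "(\<exists>b\<in>universe B. sat B (e(x := b)) \<chi> = True) =
    (\<exists>a\<in>universe A. sat A ((extend (hmap S) \<circ> e)(x := a)) \<chi> = True)"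
  proof (rule quantifier_transfer)
    show "sat B e \<chi> \<longleftrightarrow> sat A (extend (hmap S) \<circ> e) \<chi>" if "live S" "e ` fv \<chi> \<subseteq> S \<union> K" for e S
      using Exists.IH[OF sub that] .
    show "card (fv \<chi> - {x}) < k" using assms(4)[OF F(2)] by simp
    show "(\<exists>a\<in>universe A. sat A ((extend h \<circ> e)(x := a)) \<chi> = True) =
      (\<exists>a\<in>universe A. sat A ((extend h' \<circ> e)(x := a)) \<chi> = True)"
      if "agree T h h'" "e ` (fv \<chi> - {x}) \<subseteq> T \<union> K" for T h h'
      using agreeD[OF that(1) F(2), of e] that(2) unfolding sat.simps by simp
    show "live (ordinary (e(x := b) ` fv \<chi>))" if b: "sat B (e(x := b)) \<chi> = True" for b
    proof (cases "ex_guarded \<chi>")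
      case True
      from b have "sat B (e(x := b)) \<chi>" by simp
      with True obtain R ts e' where e': "sat B e' (Rel R ts)" "fv \<chi> \<subseteq> fv (Rel R ts)"
          "\<forall>y\<in>fv \<chi>. e' y = (e(x := b)) y"
        by (rule sat_ex_guarded)
      have "e(x := b) ` fv \<chi> = e' ` fv \<chi>" using e'(3) by (intro image_cong) auto
      then have "ordinary (e(x := b) ` fv \<chi>) \<subseteq> ordinary (e' ` fv (Rel R ts))"
        using e'(2) by (auto simp: ordinary_def simp del: fv.simps)
      then show ?thesis using sat_B_Rel_live[OF e'(1)] live_subset by blast
    next
      case False
      then have "card (fv \<chi>) \<le> 2" using Exists.prems by simp
      then show ?thesis by (rule live_ordinary_image)
    qed
  qed (use Exists.prems F in auto)
  then show ?case unfolding sat.simps by simp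
next
  case (Forall x \<chi>)
  have sub: "triguarded \<chi>" "subfms \<chi> \<subseteq> F" "consts_fm \<chi> \<subseteq> C"
    using Forall.prems by simp_all
  have F: "\<chi> \<in> F" "Forall x \<chi> \<in> F" using Forall.prems(2) subfms_refl[of \<chi>] by auto
  \<comment> \<open>A universal quantifier is transferred through its counterexamples.\<close>
  have "(\<exists>b\<in>universe B. sat B (e(x := b)) \<chi> = False) =
    (\<exists>a\<in>universe A. sat A ((extend (hmap S) \<circ> e)(x := a)) \<chi> = False)"
  proof (rule quantifier_transfer)
    show "sat B e \<chi> \<longleftrightarrow> sat A (extend (hmap S) \<circ> e) \<chi>" if "live S" "e ` fv \<chi> \<subseteq> S \<union> K" for e S
      using Forall.IH[OF sub that] .
    show "card (fv \<chi> - {x}) < k" using assms(4)[OF F(2)] by simp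
    show "(\<exists>a\<in>universe A. sat A ((extend h \<circ> e)(x := a)) \<chi> = False) =
      (\<exists>a\<in>universe A. sat A ((extend h' \<circ> e)(x := a)) \<chi> = False)"
      if "agree T h h'" "e ` (fv \<chi> - {x}) \<subseteq> T \<union> K" for T h h'
      using agreeD[OF that(1) F(2), of e] that(2) unfolding sat.simps fv.simps by blast
    show "live (ordinary (e(x := b) ` fv \<chi>))" if b: "sat B (e(x := b)) \<chi> = False" for b
    proof (cases "all_guarded \<chi>")
      case True
      from b have "\<not> sat B (e(x := b)) \<chi>" by simp
      with True obtain R ts e' where e': "sat B e' (Rel R ts)" "fv \<chi> \<subseteq> fv (Rel R ts)"
          "\<forall>y\<in>fv \<chi>. e' y = (e(x := b)) y"
        by (rule not_sat_all_guarded)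
      have "e(x := b) ` fv \<chi> = e' ` fv \<chi>" using e'(3) by (intro image_cong) auto
      then have "ordinary (e(x := b) ` fv \<chi>) \<subseteq> ordinary (e' ` fv (Rel R ts))"
        using e'(2) by (auto simp: ordinary_def simp del: fv.simps)
      then show ?thesis using sat_B_Rel_live[OF e'(1)] live_subset by blast
    next
      case False
      then have "card (fv \<chi>) \<le> 2" using Forall.prems by simp
      then show ?thesis by (rule live_ordinary_image)
    qed
  qed (use Forall.prems F in auto)
  then show ?case unfolding sat.simps by blast
next
  case (Neg \<psi>)
  then show ?case by simp
next
  case (Conj \<psi> \<chi>)
  then show ?case by (simp add: image_Un)
next
  case (Disj \<psi> \<chi>)
  then show ?case by (simp add: image_Un)
next
  case (Imp \<psi> \<chi>)
  then show ?case by (simp add: image_Un)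
next
  case (Iff \<psi> \<chi>)
  then show ?case by (simp add: image_Un)
qed simp

lemma finite_model:
  assumes "is_model ar A \<phi>" "sentence \<phi>" "triguarded \<phi>" "subfms \<phi> \<subseteq> F" "consts_fm \<phi> \<subseteq> C"
    and "\<And>\<theta>. \<theta> \<in> F \<Longrightarrow> card (fv \<theta>) < k"
  shows "is_model ar B \<phi>" "finite (universe B)" "card (universe B) \<le> N + card C"
proof -
  have A: "is_struct ar A" "\<And>e. range e \<subseteq> universe A \<Longrightarrow> sat A e \<phi>"
    using assms(1) by (auto simp: is_model_def)
  have univ: "universe B = {..<N} \<union> K" by (simp add: B_def)
  have "length as = ar R" if "map f as \<in> rel_of A R" for f :: "nat \<Rightarrow> 'a" and as R
    using A(1) that unfolding is_struct_def by (metis (mono_tags) length_map mem_Collect_eq subsetD)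
  then have "is_struct ar B"
    unfolding is_struct_def using N_pos by (auto simp: B_def K_def)
  \<comment> \<open>A sentence has no free variables, so the empty set, which is live, covers every
    assignment.\<close>
  moreover have "sat B e \<phi>" for e
  proof -
    have "range (extend (hmap {}) \<circ> e) \<subseteq> universe A"
      using extend_in_univ[OF range_hmap[OF live_empty]] by auto
    then have "sat A (extend (hmap {}) \<circ> e) \<phi>" by (rule A(2))
    then show ?thesis
      using truth[OF assms(3-6) live_empty, of e] assms(2) by (simp add: sentence_def)
  qed
  ultimately show "is_model ar B \<phi>" by (simp add: is_model_def)
  show "finite (universe B)" using finite_C by (simp add: univ K_def)
  have "card (universe B) \<le> card {..<N} + card K" unfolding univ by (rule card_Un_le)
  also have "card K \<le> card C" unfolding K_def using finite_C by (rule card_image_le)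
  finally show "card (universe B) \<le> N + card C" by simp
qed

end

section \<open>Estimates\<close>

lemma square_less_two_power: "5 \<le> q \<Longrightarrow> q * q < 2 ^ q" for q :: nat
proof (induction q rule: nat_induct_at_least)
  case (Suc q)
  have "5 * q \<le> q * q" using Suc.hyps by (intro mult_right_mono) auto
  then have "2 * q + 1 \<le> q * q" using Suc.hyps by linarith
  then have "Suc q * Suc q \<le> 2 * (q * q)" by simp
  then show ?case using Suc.IH by simp
qed simp

text \<open>Put \<open>Q = 2 ^ q\<close>. After \<open>Q * Q\<close> trials the failure factor is at
  most \<open>exp (- Q)\<close>, hence at most \<open>(1 / 2) ^ Q\<close>. The remaining factor is
  at most \<open>2 ^ (q * (3 * k + 1))\<close>, because \<open>Q * Q + k + 1\<close> is at most
  \<open>Q ^ 3\<close>, and this is below \<open>2 ^ Q\<close>.\<close>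

lemma union_bound_less_1:
  fixes q k M :: nat
  assumes "real M \<le> 2 ^ q" "q * (3 * k + 1) < 2 ^ q" "k + 2 \<le> 2 ^ q"
  shows "real M * real (2 ^ q * 2 ^ q + k + 1) ^ k * (1 - 1 / 2 ^ q) ^ (2 ^ q * 2 ^ q) < 1"
proof -
  define Q :: nat where "Q = 2 ^ q"
  have Q: "2 \<le> Q" using assms(3) by (simp add: Q_def)
  have "Q * 1 \<le> Q * (Q * (Q - 1))" using Q by (intro mult_left_mono) auto
  then have "Q * Q + Q \<le> Q * Q * Q" using Q by (cases Q) (auto simp: algebra_simps)
  then have "Q * Q + k + 1 \<le> Q * Q * Q" using assms(3) by (simp add: Q_def)
  also have "Q * Q * Q = 2 ^ (3 * q)" by (simp add: Q_def flip: power_add)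
  finally have "real (Q * Q + k + 1) \<le> 2 ^ (3 * q)"
    by (metis of_nat_le_iff of_nat_numeral of_nat_power)
  then have "real (Q * Q + k + 1) ^ k \<le> (2 ^ (3 * q)) ^ k" by (intro power_mono) auto
  then have "real M * real (Q * Q + k + 1) ^ k \<le> 2 ^ q * (2 ^ (3 * q)) ^ k"
    using assms(1) by (intro mult_mono) auto
  also have "\<dots> = 2 ^ (q * (3 * k + 1))"
    by (simp add: power_add power_mult[symmetric] algebra_simps)
  also have "\<dots> < (2::real) ^ Q" using assms(2) by (intro power_strict_increasing) (auto simp: Q_def)
  finally have 1: "real M * real (Q * Q + k + 1) ^ k < 2 ^ Q" .
  have "(1 - 1 / real Q) ^ (Q * Q) \<le> exp (- 1 / real Q) ^ (Q * Q)"
    using exp_ge_add_one_self[of "- 1 / real Q"] Q by (intro power_mono) auto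
  also have "\<dots> = exp (real (Q * Q) * (- 1 / real Q))" by (rule exp_of_nat_mult[symmetric])
  also have "\<dots> = exp (- real Q)" using Q by simp
  also have "\<dots> = exp (- 1) ^ Q" using exp_of_nat_mult[of Q "- 1 :: real"] by simp
  also have "\<dots> \<le> (1 / 2) ^ Q"
    using exp_ge_add_one_self[of "1::real"] by (intro power_mono) (auto simp: exp_minus field_simps)
  finally have 2: "(1 - 1 / real Q) ^ (Q * Q) \<le> (1 / 2) ^ Q" .
  have "real M * real (Q * Q + k + 1) ^ k * (1 - 1 / real Q) ^ (Q * Q)
      \<le> real M * real (Q * Q + k + 1) ^ k * (1 / 2) ^ Q"
    using 2 by (intro mult_left_mono) auto
  also have "\<dots> < 2 ^ Q * (1 / 2) ^ Q" using 1 by (intro mult_strict_right_mono) auto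
  also have "\<dots> = 1" by (simp add: power_mult_distrib[symmetric])
  finally show ?thesis by (simp add: Q_def)
qed

lemma fm_length_ge_3: "3 \<le> fm_length \<phi>"
  by (induction \<phi>) auto

section \<open>Choice of the parameters and the final bound\<close>

theorem theorem4:
  shows "\<exists>C::real. C > 0 \<and>
    (\<forall>(ar :: nat \<Rightarrow> nat) (\<phi> :: fm).
       respects_arity ar \<phi> \<longrightarrow> \<phi> \<in> TGF \<longrightarrow> equality_free \<phi> \<longrightarrow> sentence \<phi> \<longrightarrow>
       satisfiable ar \<phi> \<longrightarrow>
       (\<exists>M :: nat struct. is_model ar M \<phi> \<and> finite (universe M) \<and>
          real (card (universe M)) \<le>
            2 powr (2 powr (C * real (fm_length \<phi>) * log 2 (real (fm_length \<phi>))))))"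
\<comment> \<open>The model has at most \<open>2 ^ (2 * q + 1)\<close> elements, and
  \<open>2 * q + 1\<close> is at most \<open>n ^ (3 * n + 3)\<close>, hence at most
  \<open>n ^ (4 * n)\<close> since \<open>n \<ge> 3\<close>; this is the 4.\<close>
proof (intro exI[of _ 4] conjI allI impI)
  fix ar \<phi>
  assume tgf: "\<phi> \<in> TGF" "equality_free \<phi>" and sent: "sentence \<phi>" and "satisfiable ar \<phi>"
  then obtain A :: "nat struct" where A: "is_model ar A \<phi>" by (auto simp: satisfiable_def)
  define n where "n = fm_length \<phi>"
  \<comment> \<open>The size limit is \<open>k = n + 1\<close>, as subformulas have at most
    \<open>n\<close> free variables. There are at most \<open>2 ^ r\<close> types, from
    \<open>n * (n * n) ^ n = n ^ (2 * n + 1)\<close>. One element fulfils a given request with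
    probability at least \<open>1 / Q\<close>, where \<open>Q = (2 ^ r) ^ 2 ^ k\<close>, and
    \<open>N - k = Q * Q\<close> trials suffice for the union bound.\<close>
  define r where "r = n ^ (2 * n + 1)"
  define q where "q = r * 2 ^ (n + 1)"
  define Q :: nat where "Q = 2 ^ q"
  define N where "N = Q * Q + (n + 1)"
  have n: "3 \<le> n" by (simp add: n_def fm_length_ge_3)
  have q_ge: "3 * n + 4 \<le> q"
  proof -
    have "n ^ 1 \<le> r" unfolding r_def using n by (intro power_increasing) auto
    moreover have "2 ^ 4 \<le> (2::nat) ^ (n + 1)" using n by (intro power_increasing) auto
    ultimately have "n * 16 \<le> q" unfolding q_def by (intro mult_mono) auto
    then show ?thesis using n by linarith
  qed
  interpret type_space A "subfms \<phi>" "consts_fm \<phi>" N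
    using A by unfold_locales (auto simp: is_model_def is_struct_def finite_consts)
  have "\<exists>d. \<forall>S h a. S \<subseteq> {..<N} \<longrightarrow> card S < n + 1 \<longrightarrow> range h \<subseteq> universe A \<longrightarrow> a \<in> universe A \<longrightarrow>
    (\<exists>b<N. b \<notin> S \<and> (\<forall>T\<subseteq>S. range (d (insert b T)) \<subseteq> universe A \<and>
       agree (insert b T) (d (insert b T)) (h(b := a))))"
  proof (rule ex_proposals[where V = "all_vars \<phi>" and M = "2 ^ r"])
    have "n + 1 + card (consts_fm \<phi>) + 1 \<le> n * n"
    proof -
      have "3 * n \<le> n * n" using n by simp
      then show ?thesis using card_consts_le[of \<phi>, folded n_def] n by linarith
    qed
    then have "card (subfms \<phi>) * (n + 1 + card (consts_fm \<phi>) + 1) ^ card (all_vars \<phi>)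
        \<le> n * (n * n) ^ n"
      using n card_subfms_le[of \<phi>] card_all_vars_le[of \<phi>]
      by (intro mult_mono order_trans[OF power_mono power_increasing]) (auto simp flip: n_def)
    also have "\<dots> = r" by (simp add: r_def power_mult_distrib power_add mult_2)
    finally show "2 ^ (card (subfms \<phi>) * (n + 1 + card (consts_fm \<phi>) + 1) ^ card (all_vars \<phi>))
        \<le> (2::nat) ^ r"
      by (intro power_increasing) auto
    have "real (2 ^ r) * real (2 ^ q * 2 ^ q + (n + 1) + 1) ^ (n + 1) *
        (1 - 1 / 2 ^ q) ^ (2 ^ q * 2 ^ q) < 1"
    proof (rule union_bound_less_1)
      show "real (2 ^ r) \<le> 2 ^ q" by (simp add: q_def)
      have "q * (3 * (n + 1) + 1) \<le> q * q" using q_ge by (intro mult_left_mono) auto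
      also have "\<dots> < 2 ^ q" using q_ge n by (intro square_less_two_power) simp
      finally show "q * (3 * (n + 1) + 1) < 2 ^ q" .
      show "n + 1 + 2 \<le> 2 ^ q" using q_ge less_exp[of q] by linarith
    qed
    moreover have "real (2 ^ r) ^ 2 ^ (n + 1) = 2 ^ q" by (simp add: q_def power_mult)
    ultimately show "real (2 ^ r) * real (N + 1) ^ (n + 1) *
        (1 - 1 / real (2 ^ r) ^ 2 ^ (n + 1)) ^ (N - (n + 1)) < 1"
      by (simp only: N_def Q_def add_diff_cancel_right')
  qed (simp_all add: finite_subfms finite_all_vars fv_subfms)
  then obtain d where d: "\<forall>S h a. S \<subseteq> {..<N} \<longrightarrow> card S < n + 1 \<longrightarrow> range h \<subseteq> universe A \<longrightarrow>
    a \<in> universe A \<longrightarrow> (\<exists>b<N. b \<notin> S \<and> (\<forall>T\<subseteq>S. range (d (insert b T)) \<subseteq> universe A \<and>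
       agree (insert b T) (d (insert b T)) (h(b := a))))" by (rule exE)
  interpret proposals A "subfms \<phi>" "consts_fm \<phi>" N "n + 1" d
  proof unfold_locales
    show "2 \<le> n + 1" using n by simp
    show "0 < N" by (simp add: N_def)
  qed (use d in simp)
  have fv: "card (fv \<theta>) < n + 1" if "\<theta> \<in> subfms \<phi>" for \<theta>
    using card_mono[OF finite_all_vars fv_subfms[OF that]] card_all_vars_le[of \<phi>]
    by (simp add: n_def)
  note model = finite_model[OF A sent TGF_triguarded[OF tgf] order_refl order_refl fv]
  have "card (universe B) \<le> Q * Q + (n + 1) + n"
    using model(3) card_consts_le[of \<phi>] by (simp add: N_def n_def)
  also have "\<dots> \<le> Q * Q + Q * Q"
  proof -
    have Q: "3 * n + 4 \<le> Q" unfolding Q_def using q_ge less_exp[of q] by linarith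
    then have "Q * 1 \<le> Q * Q" by (intro mult_left_mono) auto
    then show ?thesis using Q by linarith
  qed
  also have "\<dots> = 2 ^ (2 * q + 1)" by (simp add: Q_def power_add mult_2)
  finally have card: "real (card (universe B)) \<le> 2 ^ (2 * q + 1)"
    by (metis of_nat_le_iff of_nat_numeral of_nat_power)
  have "2 * q + 1 \<le> 3 * q" using q_ge by simp
  also have "\<dots> \<le> n * (n ^ (2 * n + 1) * n ^ (n + 1))"
    unfolding q_def r_def using n by (intro mult_mono power_mono) auto
  also have "\<dots> = n ^ (3 * n + 3)" by (simp add: numeral_3_eq_3 flip: power_add power_Suc)
  also have "\<dots> \<le> n ^ (4 * n)" using n by (intro power_increasing) auto
  finally have exponent: "real (2 * q + 1) \<le> real n ^ (4 * n)"
    by (metis of_nat_le_iff of_nat_power)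
  have "2 powr (4 * real n * log 2 (real n)) = (2 powr log 2 (real n)) powr (real (4 * n))"
    by (simp add: powr_powr mult.commute)
  also have "\<dots> = real n powr real (4 * n)" using n by simp
  also have "\<dots> = real n ^ (4 * n)" using n by (intro powr_realpow) simp
  finally have "real (2 * q + 1) \<le> 2 powr (4 * real n * log 2 (real n))" using exponent by simp
  then have "2 powr real (2 * q + 1) \<le> 2 powr (2 powr (4 * real n * log 2 (real n)))"
    by (intro powr_mono) auto
  then have "real (card (universe B)) \<le> 2 powr (2 powr (4 * real n * log 2 (real n)))"
    using card by (simp only: powr_realpow zero_less_numeral)
  then show "\<exists>M :: nat struct. is_model ar M \<phi> \<and> finite (universe M) \<and>
      real (card (universe M)) \<le>
        2 powr (2 powr (4 * real (fm_length \<phi>) * log 2 (real (fm_length \<phi>))))"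
    using model(1,2) unfolding n_def by blast
qed simp

end
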